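(* Let $t$ be a positive integer and $\mu$ a $t$-core partition. For every partition $\lambda$ with $t$-core $\mu$, $$\sum_{\substack{\square\in\lambda\\ h_\square\equiv0\ (\mathrm{mod}\ t)}}h_\square^2-\sum_{\substack{\square\in\lambda\\ c_\square\equiv0\ (\mathrm{mod}\ t)}}c_\square^2=t^2\sum_{i=0}^{t-1}\Bigl(n_i^2-d_i^2n_i-\tfrac13d_iq_3(\lambda^i)\Bigr)-\sum_{\substack{\square\in\mu\\ c_\square\equiv0\ (\mathrm{mod}\ t)}}c_\square^2,$$ where $n_i=|\lambda^i|$.
   Context: Partitions are identified with Young diagrams (box $(i,j)$ in row $i$, column $j$; content $c_\square=j-i$); $h_\square$ is the hook length (boxes to its right in its row, plus below it in its column, plus one). A $t$-core has no hook length divisible by $t$. The 01-sequence $(z_j)_{j\in\mathbb Z}$: traverse the boundary of the Young diagram from the bottom (infinite vertical ray below the first column) to the right (infinite horizontal ray right of the first row), labelling vertical edges $0$ and horizontal edges $1$, indexed so that $\#\{j\ge0:z_j=0\}=\#\{j<0:z_j=1\}$. Removing a $t$-hook exchanges some $z_j=1,z_{j+t}=0$ into $0,1$; the $t$-core is obtained by removing $t$-hooks until impossible. The $i$-th $t$-quotient $\lambda^i$ ($0\le i\le t-1$) is the partition with 01-sequence $(z_{tj+i})_{j\in\mathbb Z}$ (up to re-indexing). For the $t$-core $\mu$ with 01-sequence $(z_{\mu,j})$: $b_i=\min\{j: j\equiv i\pmod t,\ z_{\mu,j}=1\}$, $d_i$ defined by $b_i=td_i+i$. For a partition $\nu$ with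 removable boxes $(\alpha_1,\beta_1),\dots,(\alpha_m,\beta_m)$, $\alpha_1>\dots>\alpha_m$, and $\alpha_{m+1}=\beta_0=0$: $q_3(\nu)=\sum_{l=0}^m(\beta_l-\alpha_{l+1})^3-\sum_{l=1}^m(\beta_l-\alpha_l)^3$. *)

theory Defs
  imports Complex_Main
begin

type_synonym box = "nat \<times> nat"

text \<open>
  A partition is identified with its Young diagram: the set of its boxes \<open>(i, j)\<close>, with row
  \<open>i \<ge> 1\<close> numbered from the top and column \<open>j \<ge> 1\<close> numbered from the left. The size of
  the partition is the cardinality of the diagram.
\<close>

definition is_partition :: "box set \<Rightarrow> bool" where
  "is_partition \<nu> \<longleftrightarrow> finite \<nu> \<and> (\<forall>(i, j) \<in> \<nu>. 1 \<le> i \<and> 1 \<le> j) \<and>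
     (\<forall>(i, j) \<in> \<nu>. \<forall>i' j'. 1 \<le> i' \<and> i' \<le> i \<and> 1 \<le> j' \<and> j' \<le> j \<longrightarrow> (i', j') \<in> \<nu>)"

definition box_content :: "box \<Rightarrow> int" where
  "box_content b = int (snd b) - int (fst b)"

definition hook_length :: "box set \<Rightarrow> box \<Rightarrow> nat" where
  "hook_length \<nu> b =
     card {j. snd b < j \<and> (fst b, j) \<in> \<nu>} + card {i. fst b < i \<and> (i, snd b) \<in> \<nu>} + 1"

definition is_core :: "nat \<Rightarrow> box set \<Rightarrow> bool" where
  "is_core t \<nu> \<longleftrightarrow> is_partition \<nu> \<and> (\<forall>b \<in> \<nu>. \<not> t dvd hook_length \<nu> b)"

text \<open>
  The box \<open>(i, j)\<close> is drawn as the unit square whose lower right corner is the lattice point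
  \<open>(i, j)\<close>, the first coordinate pointing down. A lattice point lies on the boundary if the square
  to its upper left belongs to the diagram (or the point lies on one of the two axes) and the square
  to its lower right does not. The boundary includes the infinite vertical ray below the first
  column and the infinite horizontal ray to the right of the first row.
\<close>

definition young_boundary :: "box set \<Rightarrow> (nat \<times> nat) set" where
  "young_boundary \<nu> = {(x, y). (x = 0 \<or> y = 0 \<or> (x, y) \<in> \<nu>) \<and> (Suc x, Suc y) \<notin> \<nu>}"

text \<open>
  \<open>boundary_word \<nu> w\<close>: the bi-infinite word \<open>w\<close> records the steps (0 = vertical, up;
  1 = horizontal, right) of a traversal \<open>p\<close> of the boundary of \<open>\<nu>\<close>. Each step moves to the
  next diagonal, and every diagonal contains exactly one boundary point, so \<open>p\<close> is the whole
  boundary. The indexing is not fixed here: every shift of \<open>w\<close> is also a boundary word of \<open>\<nu>\<close>.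
\<close>

definition boundary_word :: "box set \<Rightarrow> (int \<Rightarrow> nat) \<Rightarrow> bool" where
  "boundary_word \<nu> w \<longleftrightarrow> (\<exists>p :: int \<Rightarrow> nat \<times> nat. \<forall>j. p j \<in> young_boundary \<nu> \<and>
     (w j = 0 \<and> fst (p j) = Suc (fst (p (j + 1))) \<and> snd (p (j + 1)) = snd (p j) \<or>
      w j = 1 \<and> fst (p (j + 1)) = fst (p j) \<and> snd (p (j + 1)) = Suc (snd (p j))))"

text \<open>
  For a partition \<open>\<nu>\<close>, a boundary word is 0 for all sufficiently small and 1 for all sufficiently
  large indices, so both sets below are finite and exactly one shift satisfies the balance
  condition.
\<close>

definition seq01 :: "box set \<Rightarrow> int \<Rightarrow> nat" where
  "seq01 \<nu> = (THE z. boundary_word \<nu> z \<and> card {j. 0 \<le> j \<and> z j = 0} = card {j. j < 0 \<and> z j = 1})"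

definition removes_hook :: "nat \<Rightarrow> box set \<Rightarrow> box set \<Rightarrow> bool" where
  "removes_hook t lam \<nu> \<longleftrightarrow> is_partition lam \<and> is_partition \<nu> \<and>
     (\<exists>j. seq01 lam j = 1 \<and> seq01 lam (j + int t) = 0 \<and>
          seq01 \<nu> = (seq01 lam)(j := 0, j + int t := 1))"

definition has_core :: "nat \<Rightarrow> box set \<Rightarrow> box set \<Rightarrow> bool" where
  "has_core t lam mu \<longleftrightarrow> (removes_hook t)\<^sup>*\<^sup>* lam mu \<and> \<not> (\<exists>\<nu>. removes_hook t mu \<nu>)"

text \<open>
  A boundary word determines its partition, and \<open>boundary_word\<close> already allows re-indexing.
\<close>

definition t_quotient :: "nat \<Rightarrow> box set \<Rightarrow> nat \<Rightarrow> box set" where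
  "t_quotient t lam i =
     (THE \<nu>. is_partition \<nu> \<and> boundary_word \<nu> (\<lambda>j. seq01 lam (int t * j + int i)))"

definition core_b :: "nat \<Rightarrow> box set \<Rightarrow> nat \<Rightarrow> int" where
  "core_b t mu i = (LEAST j. j mod int t = int i mod int t \<and> seq01 mu j = 1)"

definition core_d :: "nat \<Rightarrow> box set \<Rightarrow> nat \<Rightarrow> int" where
  "core_d t mu i = (THE d. core_b t mu i = int t * d + int i)"

definition removable_boxes :: "box set \<Rightarrow> box set" where
  "removable_boxes \<nu> = {(i, j). (i, j) \<in> \<nu> \<and> (Suc i, j) \<notin> \<nu> \<and> (i, Suc j) \<notin> \<nu>}"

text \<open>
  The removable boxes \<open>(\<alpha>\<^sub>1, \<beta>\<^sub>1), \<dots>, (\<alpha>\<^sub>m, \<beta>\<^sub>m)\<close> in order of decreasing row. Distinct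
  removable boxes lie in distinct rows, so sorting by row is unambiguous.
\<close>

definition corners :: "box set \<Rightarrow> box list" where
  "corners \<nu> = rev (sorted_key_list_of_set fst (removable_boxes \<nu>))"

definition corner_row :: "box set \<Rightarrow> nat \<Rightarrow> int" where
  "corner_row \<nu> l = (if 1 \<le> l \<and> l \<le> card (removable_boxes \<nu>) then int (fst (corners \<nu> ! (l - 1))) else 0)"

definition corner_col :: "box set \<Rightarrow> nat \<Rightarrow> int" where
  "corner_col \<nu> l = (if 1 \<le> l \<and> l \<le> card (removable_boxes \<nu>) then int (snd (corners \<nu> ! (l - 1))) else 0)"

definition q3 :: "box set \<Rightarrow> int" where
  "q3 \<nu> = (\<Sum>l = 0..card (removable_boxes \<nu>). (corner_col \<nu> l - corner_row \<nu> (l + 1)) ^ 3)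
        - (\<Sum>l = 1..card (removable_boxes \<nu>). (corner_col \<nu> l - corner_row \<nu> l) ^ 3)"

end

theory Submission
  imports Defs
begin

text \<open>
  A word with \<open>w = 0\<close> far left and \<open>w = 1\<close> far right has a diagram whose boxes correspond to the
  inversions \<open>j < k\<close>, \<open>w j = 1\<close>, \<open>w k = 0\<close>, with hook length \<open>k - j\<close>. Restricting to a residue
  class of indices modulo \<open>t\<close> therefore matches the hooks of length divisible by \<open>t\<close> with \<open>t\<close> times
  the hooks of the quotients. Summing row by row, \<open>\<Sum> g (c + d)\<close> over the boxes, for a word of
  charge \<open>d\<close>, is the sum over the zeros of an antidifference \<open>S\<close> of \<open>g\<close>, up to a term depending
  on \<open>d\<close> only. For \<open>g c = c\<^sup>2\<close> restricted to multiples of \<open>t\<close>, \<open>S k\<close> depends only on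
  \<open>k div t\<close>, and the charges of the residue classes are the \<open>d\<^sub>i\<close> of the core, so the squared
  contents divisible by \<open>t\<close> exceed those of the core by \<open>t\<^sup>2 \<Sum>\<^sub>i \<Sum> (c + d\<^sub>i)\<^sup>2\<close>, the inner sum
  over the contents of the \<open>i\<close>-th quotient. What remains are two identities for a single partition
  of size \<open>n\<close>: \<open>\<Sum> h\<^sup>2 = n\<^sup>2 + \<Sum> c\<^sup>2\<close> and \<open>q\<^sub>3 = 6 \<Sum> c\<close>.
\<close>

section \<open>Words and their diagrams\<close>

definition zeros_from :: "(int \<Rightarrow> nat) \<Rightarrow> int \<Rightarrow> nat" where
  "zeros_from w j = card {k. j \<le> k \<and> w k = 0}"

definition ones_below :: "(int \<Rightarrow> nat) \<Rightarrow> int \<Rightarrow> nat" where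
  "ones_below w j = card {k. k < j \<and> w k = 1}"

definition charge :: "(int \<Rightarrow> nat) \<Rightarrow> int" where
  "charge w = int (zeros_from w 0) - int (ones_below w 0)"

definition diagram :: "(int \<Rightarrow> nat) \<Rightarrow> box set" where
  "diagram w = {(a, b). 1 \<le> a \<and> 1 \<le> b \<and> (\<exists>j. a \<le> zeros_from w j \<and> b \<le> ones_below w j)}"

definition inversions :: "(int \<Rightarrow> nat) \<Rightarrow> (int \<times> int) set" where
  "inversions w = {(j, k). j < k \<and> w j = 1 \<and> w k = 0}"

locale maya_word =
  fixes w :: "int \<Rightarrow> nat" and L M :: int
  assumes binary: "w k = 0 \<or> w k = 1"
    and low: "k < L \<Longrightarrow> w k = 0"
    and high: "M \<le> k \<Longrightarrow> w k = 1"
begin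

lemma finite_between: "finite {k \<in> {L..<M}. w k = n}"
  by (rule finite_subset[of _ "{L..<M}"]) auto

lemma finite_zeros: "finite {k. j \<le> k \<and> w k = 0}"
proof (rule finite_subset)
  show "{k. j \<le> k \<and> w k = 0} \<subseteq> {j..<M}"
    using high by (force simp: not_le[symmetric])
qed simp

lemma finite_ones: "finite {k. k < j \<and> w k = 1}"
proof (rule finite_subset)
  show "{k. k < j \<and> w k = 1} \<subseteq> {L..<j}"
    using low by (force simp: not_le[symmetric])
qed simp

lemma zero_step:
  assumes "w j = 0"
  shows "zeros_from w j = Suc (zeros_from w (j + 1))" "ones_below w (j + 1) = ones_below w j"
proof -
  have "{k. j \<le> k \<and> w k = 0} = insert j {k. j + 1 \<le> k \<and> w k = 0}"
    using assms by force
  then show "zeros_from w j = Suc (zeros_from w (j + 1))"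
    using finite_zeros[of "j + 1"] by (simp add: zeros_from_def)
  have "k < j + 1 \<and> w k = 1 \<longleftrightarrow> k < j \<and> w k = 1" for k
    using assms by (cases "k = j") auto
  then show "ones_below w (j + 1) = ones_below w j"
    by (simp only: ones_below_def)
qed

lemma one_step:
  assumes "w j = 1"
  shows "zeros_from w (j + 1) = zeros_from w j" "ones_below w (j + 1) = Suc (ones_below w j)"
proof -
  have "{k. k < j + 1 \<and> w k = 1} = insert j {k. k < j \<and> w k = 1}"
    using assms by force
  then show "ones_below w (j + 1) = Suc (ones_below w j)"
    using finite_ones[of j] by (simp add: ones_below_def)
  have "{k. j \<le> k \<and> w k = 0} = {k. j + 1 \<le> k \<and> w k = 0}"
    using assms by (auto simp: order_le_less)
  then show "zeros_from w (j + 1) = zeros_from w j"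
    by (simp add: zeros_from_def)
qed

lemma diagonal: "int (ones_below w j) - int (zeros_from w j) = j - charge w"
proof (induction j rule: int_induct[where k = 0])
  case base
  then show ?case by (simp add: charge_def)
next
  case (step1 i)
  then show ?case using binary[of i] zero_step[of i] one_step[of i] by auto
next
  case (step2 i)
  then show ?case using binary[of "i - 1"] zero_step[of "i - 1"] one_step[of "i - 1"] by auto
qed

lemma zeros_from_antimono: "i \<le> j \<Longrightarrow> zeros_from w j \<le> zeros_from w i"
  unfolding zeros_from_def by (rule card_mono[OF finite_zeros]) auto

lemma ones_below_mono: "i \<le> j \<Longrightarrow> ones_below w i \<le> ones_below w j"
  unfolding ones_below_def by (rule card_mono[OF finite_ones]) auto

lemma zeros_from_high:
  assumes "M \<le> j"
  shows "zeros_from w j = 0"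
proof -
  have "{k. j \<le> k \<and> w k = 0} = {}"
    using high assms by force
  then show ?thesis by (simp only: zeros_from_def card.empty)
qed

lemma ones_below_low:
  assumes "j \<le> L"
  shows "ones_below w j = 0"
proof -
  have "{k. k < j \<and> w k = 1} = {}"
    using low assms by force
  then show ?thesis by (simp only: ones_below_def card.empty)
qed

lemma zeros_from_low: "int (zeros_from w L) = charge w - L"
  using diagonal[of L] ones_below_low[of L] by simp

lemma zero_index:
  assumes "w k = 0" "zeros_from w k \<le> zeros_from w m"
  shows "m \<le> k"
proof (rule ccontr)
  assume "\<not> m \<le> k"
  then have "zeros_from w m \<le> zeros_from w (k + 1)" by (intro zeros_from_antimono) simp
  then show False using zero_step[OF assms(1)] assms(2) by simp
qed

lemma one_index:
  assumes "w j = 1" "ones_below w (j + 1) \<le> ones_below w m"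
  shows "j < m"
proof (rule ccontr)
  assume "\<not> j < m"
  then have "ones_below w m \<le> ones_below w j" by (intro ones_below_mono) simp
  then show False using one_step[OF assms(1)] assms(2) by simp
qed

lemma in_row_iff:
  assumes "w k = 0"
  shows "(zeros_from w k, b) \<in> diagram w \<longleftrightarrow> 1 \<le> b \<and> b \<le> ones_below w k"
proof
  assume "(zeros_from w k, b) \<in> diagram w"
  then obtain j where "1 \<le> b" "zeros_from w k \<le> zeros_from w j" "b \<le> ones_below w j"
    by (auto simp: diagram_def)
  then show "1 \<le> b \<and> b \<le> ones_below w k"
    using zero_index[OF assms] ones_below_mono order_trans by blast
next
  assume "1 \<le> b \<and> b \<le> ones_below w k"
  then show "(zeros_from w k, b) \<in> diagram w"
    using zero_step(1)[OF assms] by (auto simp: diagram_def simp del: One_nat_def intro!: exI[of _ k])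
qed

lemma in_column_iff:
  assumes "w j = 1"
  shows "(a, ones_below w (j + 1)) \<in> diagram w \<longleftrightarrow> 1 \<le> a \<and> a \<le> zeros_from w (j + 1)"
proof
  assume "(a, ones_below w (j + 1)) \<in> diagram w"
  then obtain m where m: "1 \<le> a" "a \<le> zeros_from w m" "ones_below w (j + 1) \<le> ones_below w m"
    by (auto simp: diagram_def)
  then have "j + 1 \<le> m" using one_index[OF assms] by force
  then show "1 \<le> a \<and> a \<le> zeros_from w (j + 1)"
    using m zeros_from_antimono order_trans by blast
next
  assume "1 \<le> a \<and> a \<le> zeros_from w (j + 1)"
  then show "(a, ones_below w (j + 1)) \<in> diagram w"
    using one_step[OF assms] by (auto simp: diagram_def intro!: exI[of _ "j + 1"])
qed

lemma bij_rows: "bij_betw (zeros_from w) {k \<in> {L..<M}. w k = 0} {1..zeros_from w L}"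
proof -
  have sub: "zeros_from w ` {k \<in> {L..<M}. w k = 0} \<subseteq> {1..zeros_from w L}"
    using zero_step zeros_from_antimono by force
  have inj: "inj_on (zeros_from w) {k \<in> {L..<M}. w k = 0}"
    by (auto intro!: inj_onI antisym zero_index)
  have "{k \<in> {L..<M}. w k = 0} = {k. L \<le> k \<and> w k = 0}"
    using high by (force simp: not_le[symmetric])
  then have "card {k \<in> {L..<M}. w k = 0} = card {1..zeros_from w L}"
    by (simp add: zeros_from_def)
  then have "zeros_from w ` {k \<in> {L..<M}. w k = 0} = {1..zeros_from w L}"
    by (intro card_subset_eq sub) (simp_all only: card_image[OF inj] finite_atLeastAtMost)
  with inj show ?thesis by (simp add: bij_betw_def)
qed

lemma bij_columns: "bij_betw (\<lambda>j. ones_below w (j + 1)) {j \<in> {L..<M}. w j = 1} {1..ones_below w M}"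
proof -
  have sub: "(\<lambda>j. ones_below w (j + 1)) ` {j \<in> {L..<M}. w j = 1} \<subseteq> {1..ones_below w M}"
  proof
    fix y assume "y \<in> (\<lambda>j. ones_below w (j + 1)) ` {j \<in> {L..<M}. w j = 1}"
    then obtain j where "j < M" "w j = 1" "y = ones_below w (j + 1)" by auto
    then show "y \<in> {1..ones_below w M}"
      using one_step[of j] ones_below_mono[of "j + 1" M] by simp
  qed
  have inj: "inj_on (\<lambda>j. ones_below w (j + 1)) {j \<in> {L..<M}. w j = 1}"
  proof (rule inj_onI)
    fix i j assume "i \<in> {j \<in> {L..<M}. w j = 1}" "j \<in> {j \<in> {L..<M}. w j = 1}"
      "ones_below w (i + 1) = ones_below w (j + 1)"
    then have "i < j + 1" "j < i + 1"
      using one_index[of i "j + 1"] one_index[of j "i + 1"] by simp_all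
    then show "i = j" by simp
  qed
  have "{j \<in> {L..<M}. w j = 1} = {k. k < M \<and> w k = 1}"
    using low by (force simp: not_le[symmetric])
  then have "card {j \<in> {L..<M}. w j = 1} = card {1..ones_below w M}"
    by (simp add: ones_below_def)
  then have "(\<lambda>j. ones_below w (j + 1)) ` {j \<in> {L..<M}. w j = 1} = {1..ones_below w M}"
    by (intro card_subset_eq sub) (simp_all only: card_image[OF inj] finite_atLeastAtMost)
  with inj show ?thesis by (simp add: bij_betw_def)
qed

lemma diagram_bounds:
  assumes "(a, b) \<in> diagram w"
  shows "a \<in> {1..zeros_from w L}" "b \<in> {1..ones_below w M}"
proof -
  obtain j where j: "1 \<le> a" "1 \<le> b" "a \<le> zeros_from w j" "b \<le> ones_below w j"
    using assms by (auto simp: diagram_def)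
  then have "L \<le> j" "j \<le> M"
    using ones_below_low[of j] zeros_from_high[of j] by force+
  then show "a \<in> {1..zeros_from w L}" "b \<in> {1..ones_below w M}"
    using j zeros_from_antimono[of L j] ones_below_mono[of j M] by auto
qed

lemma is_partition_diagram: "is_partition (diagram w)"
proof -
  have "diagram w \<subseteq> {1..zeros_from w L} \<times> {1..ones_below w M}"
    using diagram_bounds by auto
  then have "finite (diagram w)" by (rule finite_subset) simp
  then show ?thesis
    unfolding is_partition_def by (auto simp: diagram_def intro: order_trans)
qed

lemma boundary_word_diagram: "boundary_word (diagram w) w"
proof -
  let ?p = "\<lambda>j. (zeros_from w j, ones_below w j)"
  have "?p j \<in> young_boundary (diagram w)" for j
  proof -
    have "(Suc (zeros_from w j), Suc (ones_below w j)) \<notin> diagram w"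
    proof
      assume "(Suc (zeros_from w j), Suc (ones_below w j)) \<in> diagram w"
      then obtain m where "zeros_from w j < zeros_from w m" "ones_below w j < ones_below w m"
        by (auto simp: diagram_def Suc_le_eq)
      then show False
        using zeros_from_antimono[of j m] ones_below_mono[of m j] by force
    qed
    then show ?thesis by (auto simp: young_boundary_def diagram_def)
  qed
  then have "?p j \<in> young_boundary (diagram w) \<and>
     (w j = 0 \<and> fst (?p j) = Suc (fst (?p (j + 1))) \<and> snd (?p (j + 1)) = snd (?p j) \<or>
      w j = 1 \<and> fst (?p (j + 1)) = fst (?p j) \<and> snd (?p (j + 1)) = Suc (snd (?p j)))" for j
    using binary[of j] zero_step[of j] one_step[of j] by auto
  then show ?thesis unfolding boundary_word_def by (intro exI[of _ ?p] allI)
qed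

lemma inversion_box_iff:
  assumes "w j = 1" "w k = 0"
  shows "(zeros_from w k, ones_below w (j + 1)) \<in> diagram w \<longleftrightarrow> j < k"
proof
  assume "(zeros_from w k, ones_below w (j + 1)) \<in> diagram w"
  then show "j < k" using in_row_iff[OF assms(2)] one_index[OF assms(1)] by blast
next
  assume "j < k"
  then have "ones_below w (j + 1) \<le> ones_below w k" by (intro ones_below_mono) simp
  then show "(zeros_from w k, ones_below w (j + 1)) \<in> diagram w"
    using in_row_iff[OF assms(2)] one_step[OF assms(1)] by simp
qed

lemma inversions_subset: "inversions w \<subseteq> {j \<in> {L..<M}. w j = 1} \<times> {k \<in> {L..<M}. w k = 0}"
proof -
  have "L \<le> j \<and> j < M \<and> L \<le> k \<and> k < M" if "j < k" "w j = 1" "w k = 0" for j k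
    using that low[of j] high[of k] by force
  then show ?thesis by (auto simp: inversions_def)
qed

lemma finite_inversions: "finite (inversions w)"
proof (rule finite_subset)
  show "inversions w \<subseteq> {L..<M} \<times> {L..<M}" using inversions_subset by auto
qed simp

lemma bij_inversions:
  "bij_betw (\<lambda>(j, k). (zeros_from w k, ones_below w (j + 1))) (inversions w) (diagram w)"
proof (rule bij_betwI')
  fix x y assume xy: "x \<in> inversions w" "y \<in> inversions w"
  obtain j k j' k' where eqs: "x = (j, k)" "y = (j', k')" by (metis surj_pair)
  have "j \<in> {j \<in> {L..<M}. w j = 1}" "j' \<in> {j \<in> {L..<M}. w j = 1}"
    "k \<in> {k \<in> {L..<M}. w k = 0}" "k' \<in> {k \<in> {L..<M}. w k = 0}"
    using xy inversions_subset unfolding eqs by blast+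
  then have "zeros_from w k = zeros_from w k' \<longleftrightarrow> k = k'"
    "ones_below w (j + 1) = ones_below w (j' + 1) \<longleftrightarrow> j = j'"
    using inj_on_eq_iff[OF bij_betw_imp_inj_on[OF bij_rows]]
      inj_on_eq_iff[OF bij_betw_imp_inj_on[OF bij_columns]] by auto
  then show "((\<lambda>(j, k). (zeros_from w k, ones_below w (j + 1))) x =
      (\<lambda>(j, k). (zeros_from w k, ones_below w (j + 1))) y) = (x = y)"
    unfolding eqs by auto
next
  fix x assume "x \<in> inversions w"
  then show "(\<lambda>(j, k). (zeros_from w k, ones_below w (j + 1))) x \<in> diagram w"
    using inversion_box_iff by (auto simp: inversions_def)
next
  fix y assume y: "y \<in> diagram w"
  obtain a b where ab: "y = (a, b)" by force
  have "a \<in> zeros_from w ` {k \<in> {L..<M}. w k = 0}"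
    "b \<in> (\<lambda>j. ones_below w (j + 1)) ` {j \<in> {L..<M}. w j = 1}"
    using y diagram_bounds bij_rows bij_columns unfolding ab bij_betw_def by auto
  then obtain j k where "w j = 1" "w k = 0" "y = (zeros_from w k, ones_below w (j + 1))"
    unfolding ab by blast
  then show "\<exists>x\<in>inversions w. y = (\<lambda>(j, k). (zeros_from w k, ones_below w (j + 1))) x"
    using y inversion_box_iff[of j k] by (intro bexI[of _ "(j, k)"]) (auto simp: inversions_def)
qed

lemma hook_length_inversion:
  assumes "(j, k) \<in> inversions w"
  shows "int (hook_length (diagram w) (zeros_from w k, ones_below w (j + 1))) = k - j"
proof -
  have jk: "w j = 1" "w k = 0" "j + 1 \<le> k" using assms by (auto simp: inversions_def)
  have Y: "ones_below w (j + 1) \<le> ones_below w k" and X: "zeros_from w k \<le> zeros_from w (j + 1)"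
    using jk ones_below_mono zeros_from_antimono by auto
  have "{b. ones_below w (j + 1) < b \<and> (zeros_from w k, b) \<in> diagram w}
      = {ones_below w (j + 1) <.. ones_below w k}"
    by (auto simp: in_row_iff[OF jk(2)])
  moreover have "{a. zeros_from w k < a \<and> (a, ones_below w (j + 1)) \<in> diagram w}
      = {zeros_from w k <.. zeros_from w (j + 1)}"
    by (auto simp: in_column_iff[OF jk(1)])
  ultimately show ?thesis
    using X Y diagonal[of k] diagonal[of "j + 1"] by (simp add: hook_length_def)
qed

lemma sum_hook_lengths:
  fixes F :: "int \<Rightarrow> real"
  shows "(\<Sum>b\<in>diagram w. F (int (hook_length (diagram w) b))) = (\<Sum>(j, k)\<in>inversions w. F (k - j))"
  by (subst sum.reindex_bij_betw[OF bij_inversions, symmetric], rule sum.cong[OF refl])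
    (use hook_length_inversion in auto)

lemma sum_contents:
  fixes g S :: "int \<Rightarrow> real"
  assumes S: "\<And>k. S k - S (k - 1) = g k"
  shows "(\<Sum>b\<in>diagram w. g (box_content b + charge w))
    = (\<Sum>k\<in>{k \<in> {L..<M}. w k = 0}. S k) - (\<Sum>k\<in>{L..<charge w}. S k)"
proof -
  let ?Z = "{k \<in> {L..<M}. w k = 0}" and ?d = "charge w"
  have rows: "diagram w = (\<lambda>(k, b). (zeros_from w k, b)) ` (SIGMA k:?Z. {1..ones_below w k})"
  proof (intro equalityI subsetI)
    fix y assume y: "y \<in> diagram w"
    obtain a b where ab: "y = (a, b)" by force
    then have "a \<in> zeros_from w ` ?Z"
      using y diagram_bounds bij_rows by (auto simp: bij_betw_def)
    then obtain k where "k \<in> ?Z" "a = zeros_from w k" by blast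
    then show "y \<in> (\<lambda>(k, b). (zeros_from w k, b)) ` (SIGMA k:?Z. {1..ones_below w k})"
      using y in_row_iff[of k b] unfolding ab by (force intro!: image_eqI[of _ _ "(k, b)"])
  qed (use in_row_iff in auto)
  have "inj_on (\<lambda>(k, b). (zeros_from w k, b)) (SIGMA k:?Z. {1..ones_below w k})"
    using bij_rows by (auto simp: inj_on_def bij_betw_def)
  then have "(\<Sum>b\<in>diagram w. g (box_content b + ?d))
    = (\<Sum>(k, b)\<in>(SIGMA k:?Z. {1..ones_below w k}). g (int b - int (zeros_from w k) + ?d))"
    unfolding rows by (subst sum.reindex) (auto simp: box_content_def intro!: sum.cong)
  also have "\<dots> = (\<Sum>k\<in>?Z. \<Sum>b\<in>{1..ones_below w k}. g (int b - int (zeros_from w k) + ?d))"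
    by (subst sum.Sigma[OF finite_between]) auto
  also have "\<dots> = (\<Sum>k\<in>?Z. S k - S (?d - int (zeros_from w k)))"
  proof (rule sum.cong[OF refl])
    fix k
    have "(\<Sum>b\<in>{1..n}. g (int b - x)) = S (int n - x) - S (- x)" for n x
    proof (induction n)
      case (Suc n)
      then show ?case using S[of "1 + int n - x"] by (simp add: algebra_simps)
    qed simp
    from this[of "int (zeros_from w k) - ?d" "ones_below w k"]
    show "(\<Sum>b\<in>{1..ones_below w k}. g (int b - int (zeros_from w k) + ?d))
        = S k - S (?d - int (zeros_from w k))"
      using diagonal[of k] by (simp add: algebra_simps)
  qed
  also have "\<dots> = (\<Sum>k\<in>?Z. S k) - (\<Sum>k\<in>?Z. S (?d - int (zeros_from w k)))"
    by (rule sum_subtractf)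
  also have "(\<Sum>k\<in>?Z. S (?d - int (zeros_from w k))) = (\<Sum>a\<in>{1..zeros_from w L}. S (?d - int a))"
    by (rule sum.reindex_bij_betw[OF bij_rows])
  also have "\<dots> = (\<Sum>k\<in>{L..<?d}. S k)"
    by (rule sum.reindex_bij_witness[of _ "\<lambda>k. nat (?d - k)" "\<lambda>a. ?d - int a"])
      (use zeros_from_low in auto)
  finally show ?thesis .
qed

end

section \<open>Boundary words of partitions\<close>

lemma partition_closed:
  assumes "is_partition \<nu>" "(i, j) \<in> \<nu>" "1 \<le> i'" "i' \<le> i" "1 \<le> j'" "j' \<le> j"
  shows "(i', j') \<in> \<nu>"
  using assms unfolding is_partition_def by blast

lemma young_boundary_unique:
  assumes "is_partition \<nu>" "P \<in> young_boundary \<nu>" "Q \<in> young_boundary \<nu>"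
    and "box_content P = box_content Q"
  shows "P = Q"
proof -
  have aux: False if "(x, y) \<in> young_boundary \<nu>" "(x', y') \<in> young_boundary \<nu>"
    "int y - int x = int y' - int x'" "x < x'" for x y x' y'
  proof -
    have "y < y'" using that(3,4) by linarith
    then have "(x', y') \<in> \<nu>" using that by (auto simp: young_boundary_def)
    then have "(Suc x, Suc y) \<in> \<nu>"
      by (rule partition_closed[OF assms(1)]) (use \<open>x < x'\<close> \<open>y < y'\<close> in auto)
    then show False using that by (auto simp: young_boundary_def)
  qed
  obtain x y x' y' where xy: "P = (x, y)" "Q = (x', y')" by (metis surj_pair)
  have diag: "int y - int x = int y' - int x'" using assms(4) by (simp add: xy box_content_def)
  have "\<not> x < x'" using aux[OF _ _ diag] assms(2,3) unfolding xy by blast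
  moreover have "\<not> x' < x" using aux[OF _ _ diag[symmetric]] assms(2,3) unfolding xy by blast
  ultimately have "x = x'" by simp
  then show ?thesis using assms(4) by (simp add: xy box_content_def)
qed

lemma young_boundary_exists:
  assumes "is_partition \<nu>"
  shows "\<exists>P \<in> young_boundary \<nu>. box_content P = j"
proof -
  define a b where "a = nat (- j)" and "b = nat j"
  let ?f = "\<lambda>m. (Suc (m + a), Suc (m + b))"
  have "finite (range ?f \<inter> \<nu>)" using assms by (simp add: is_partition_def)
  moreover have "infinite (range ?f)" 
    using finite_imageD[of ?f UNIV] infinite_UNIV_nat by (auto simp: inj_on_def)
  ultimately have "\<not> range ?f \<subseteq> \<nu>" by (metis Int_absorb2)
  then obtain m0 where m0: "?f m0 \<notin> \<nu>" by blast
  define m where "m = (LEAST m. ?f m \<notin> \<nu>)"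
  have m: "?f m \<notin> \<nu>" unfolding m_def by (rule LeastI[of _ m0]) (rule m0)
  have "m + a = 0 \<or> m + b = 0 \<or> (m + a, m + b) \<in> \<nu>"
  proof (cases m)
    case 0
    then show ?thesis by (auto simp: a_def b_def)
  next
    case (Suc m')
    then have "?f m' \<in> \<nu>" using not_less_Least[of m' "\<lambda>m. ?f m \<notin> \<nu>"] by (auto simp: m_def)
    then show ?thesis by (simp add: Suc)
  qed
  with m show ?thesis
    by (intro bexI[of _ "(m + a, m + b)"]) (auto simp: young_boundary_def box_content_def a_def b_def)
qed

definition boundary_path :: "box set \<Rightarrow> (int \<Rightarrow> nat) \<Rightarrow> (int \<Rightarrow> nat \<times> nat) \<Rightarrow> bool" where
  "boundary_path \<nu> w p \<longleftrightarrow> (\<forall>j. p j \<in> young_boundary \<nu> \<and>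
     (w j = 0 \<and> fst (p j) = Suc (fst (p (j + 1))) \<and> snd (p (j + 1)) = snd (p j) \<or>
      w j = 1 \<and> fst (p (j + 1)) = fst (p j) \<and> snd (p (j + 1)) = Suc (snd (p j))))"

lemma boundary_word_iff_path: "boundary_word \<nu> w \<longleftrightarrow> (\<exists>p. boundary_path \<nu> w p)"
  by (simp add: boundary_word_def boundary_path_def)

lemma boundary_path_counts:
  assumes "is_partition \<nu>" "boundary_path \<nu> w p"
  shows "(\<exists>L M. maya_word w L M) \<and> (\<forall>j. p j = (zeros_from w j, ones_below w j))"
proof -
  have step: "w j = 0 \<and> fst (p j) = Suc (fst (p (j + 1))) \<and> snd (p (j + 1)) = snd (p j) \<or>
      w j = 1 \<and> fst (p (j + 1)) = fst (p j) \<and> snd (p (j + 1)) = Suc (snd (p j))"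
    for j
    using assms(2) unfolding boundary_path_def by blast
  have bd: "fst (p j) = 0 \<or> snd (p j) = 0 \<or> p j \<in> \<nu>" for j
  proof -
    have "p j \<in> young_boundary \<nu>" using assms(2) by (auto simp: boundary_path_def)
    then show ?thesis by (cases "p j") (auto simp: young_boundary_def)
  qed
  define c where "c = box_content (p 0)"
  have diag: "box_content (p j) = j + c" for j
  proof (induction j rule: int_induct[where k = 0])
    case base
    then show ?case by (simp add: c_def)
  next
    case (step1 i)
    then show ?case using step[of i] by (auto simp: box_content_def)
  next
    case (step2 i)
    then show ?case using step[of "i - 1"] by (auto simp: box_content_def)
  qed
  have "finite (fst ` \<nu> \<union> snd ` \<nu>)" using assms(1) by (simp add: is_partition_def)
  then obtain N where "\<forall>n \<in> fst ` \<nu> \<union> snd ` \<nu>. n \<le> N"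
    by (meson finite_nat_set_iff_bounded_le)
  then have N: "fst b \<le> N \<and> snd b \<le> N" if "b \<in> \<nu>" for b
    using that by blast
  define M where "M = int N + 1 - c"
  define L where "L = - int N - 1 - c"
  have X0: "fst (p j) = 0" if "M \<le> j" for j
    using diag[of j] bd[of j] N[of "p j"] that by (auto simp: M_def box_content_def)
  have Y0: "snd (p j) = 0" if "j \<le> L" for j
    using diag[of j] bd[of j] N[of "p j"] that by (auto simp: L_def box_content_def)
  interpret maya_word w L M
  proof
    fix k
    show "w k = 0 \<or> w k = 1" using step by blast
    show "w k = 0" if "k < L" using step[of k] Y0[of "k + 1"] that by auto
    show "w k = 1" if "M \<le> k" using step[of k] X0[of k] that by auto
  qed
  have "fst (p j) = zeros_from w j" for j
  proof (induction j rule: int_induct[where k = M])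
    case base
    then show ?case using X0[of M] zeros_from_high[of M] by simp
  next
    case (step1 i)
    then show ?case using step[of i] zero_step[of i] one_step[of i] by auto
  next
    case (step2 i)
    then show ?case using step[of "i - 1"] zero_step[of "i - 1"] one_step[of "i - 1"] by auto
  qed
  moreover have "snd (p j) = ones_below w j" for j
  proof (induction j rule: int_induct[where k = L])
    case base
    then show ?case using Y0[of L] ones_below_low[of L] by simp
  next
    case (step1 i)
    then show ?case using step[of i] zero_step[of i] one_step[of i] by auto
  next
    case (step2 i)
    then show ?case using step[of "i - 1"] zero_step[of "i - 1"] one_step[of "i - 1"] by auto
  qed
  ultimately have "\<forall>j. p j = (zeros_from w j, ones_below w j)" by (simp add: prod_eq_iff)
  then show ?thesis using maya_word_axioms by blast
qed

lemma boundary_word_diagram_eq: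
  assumes "is_partition \<nu>" "boundary_word \<nu> w"
  shows "\<nu> = diagram w"
proof -
  obtain p where p: "boundary_path \<nu> w p" using assms(2) by (auto simp: boundary_word_iff_path)
  obtain L M where "maya_word w L M" and pj: "\<And>j. p j = (zeros_from w j, ones_below w j)"
    using boundary_path_counts[OF assms(1) p] by blast
  then interpret maya_word w L M by simp
  have bd: "(zeros_from w j, ones_below w j) \<in> young_boundary \<nu>" for j
    using p pj by (metis boundary_path_def)
  have "(a, b) \<in> \<nu> \<longleftrightarrow> (a, b) \<in> diagram w" for a b
  proof
    assume ab: "(a, b) \<in> \<nu>"
    define j where "j = int b - int a + charge w"
    have diag: "int (ones_below w j) - int (zeros_from w j) = int b - int a"
      using diagonal[of j] by (simp add: j_def)
    have "a \<le> zeros_from w j"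
    proof (rule ccontr)
      assume "\<not> a \<le> zeros_from w j"
      then have "(Suc (zeros_from w j), Suc (ones_below w j)) \<in> \<nu>"
        by (intro partition_closed[OF assms(1) ab]) (use diag in auto)
      then show False using bd[of j] by (auto simp: young_boundary_def)
    qed
    moreover from this have "b \<le> ones_below w j" using diag by simp
    moreover have "1 \<le> a" "1 \<le> b" using ab assms(1) by (auto simp: is_partition_def)
    ultimately show "(a, b) \<in> diagram w" by (auto simp: diagram_def)
  next
    assume "(a, b) \<in> diagram w"
    then obtain j where j: "1 \<le> a" "1 \<le> b" "a \<le> zeros_from w j" "b \<le> ones_below w j"
      by (auto simp: diagram_def)
    then have "(zeros_from w j, ones_below w j) \<in> \<nu>"
      using bd[of j] by (auto simp: young_boundary_def)
    then show "(a, b) \<in> \<nu>" by (rule partition_closed[OF assms(1)]) (use j in auto)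
  qed
  then show ?thesis by auto
qed

lemma boundary_word_unique:
  assumes \<nu>: "is_partition \<nu>" and w: "boundary_word \<nu> w" and w': "boundary_word \<nu> w'"
    and "charge w = charge w'"
  shows "w = w'"
proof -
  obtain p where p: "boundary_path \<nu> w p" using w by (auto simp: boundary_word_iff_path)
  obtain p' where p': "boundary_path \<nu> w' p'" using w' by (auto simp: boundary_word_iff_path)
  have "p j = p' j" for j
  proof (rule young_boundary_unique[OF \<nu>])
    show "p j \<in> young_boundary \<nu>" "p' j \<in> young_boundary \<nu>"
      using p p' by (auto simp: boundary_path_def)
    show "box_content (p j) = box_content (p' j)"
      using boundary_path_counts[OF \<nu> p] boundary_path_counts[OF \<nu> p'] assms(4)
        maya_word.diagonal[of w _ _ j] maya_word.diagonal[of w' _ _ j]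
      by (auto simp: box_content_def)
  qed
  show "w = w'"
  proof
    fix j
    show "w j = w' j"
      using p p' \<open>p j = p' j\<close> \<open>p (j + 1) = p' (j + 1)\<close> unfolding boundary_path_def
      by (metis n_not_Suc_n)
  qed
qed

lemma balanced_boundary_word_exists:
  assumes \<nu>: "is_partition \<nu>"
  shows "\<exists>w. boundary_word \<nu> w \<and> charge w = 0"
proof -
  obtain p where p: "\<And>j. p j \<in> young_boundary \<nu>" "\<And>j. box_content (p j) = j"
    using young_boundary_exists[OF \<nu>] by metis
  define w :: "int \<Rightarrow> nat" where "w j = (if fst (p (j + 1)) = fst (p j) then 1 else 0)" for j
  have step: "p (j + 1) = (x, Suc y) \<or> (\<exists>x'. x = Suc x' \<and> p (j + 1) = (x', y))"
    if xy: "p j = (x, y)" for j x y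
  proof (cases "x = 0 \<or> (x, Suc y) \<in> \<nu>")
    case True
    have "(Suc x, Suc (Suc y)) \<notin> \<nu>"
      using p(1)[of j] xy partition_closed[OF \<nu>, of "Suc x" "Suc (Suc y)" "Suc x" "Suc y"]
      by (auto simp: young_boundary_def)
    with True have "(x, Suc y) \<in> young_boundary \<nu>" by (auto simp: young_boundary_def)
    then have "p (j + 1) = (x, Suc y)"
      using p p(2)[of j] xy by (intro young_boundary_unique[OF \<nu>]) (auto simp: box_content_def)
    then show ?thesis by simp
  next
    case False
    then obtain x' where x': "x = Suc x'" by (cases x) auto
    have "x' = 0 \<or> y = 0 \<or> (x', y) \<in> \<nu>"
      using p(1)[of j] xy x' partition_closed[OF \<nu>, of x y x' y]
      by (auto simp: young_boundary_def Suc_le_eq)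
    with False have "(x', y) \<in> young_boundary \<nu>" by (auto simp: young_boundary_def x')
    then have "p (j + 1) = (x', y)"
      using p p(2)[of j] xy x' by (intro young_boundary_unique[OF \<nu>]) (auto simp: box_content_def)
    then show ?thesis using x' by simp
  qed
  have path: "boundary_path \<nu> w p"
    unfolding boundary_path_def
  proof (intro allI conjI p)
    fix j
    show "w j = 0 \<and> fst (p j) = Suc (fst (p (j + 1))) \<and> snd (p (j + 1)) = snd (p j) \<or>
      w j = 1 \<and> fst (p (j + 1)) = fst (p j) \<and> snd (p (j + 1)) = Suc (snd (p j))"
      using step[of j "fst (p j)" "snd (p j)"] by (auto simp: w_def)
  qed
  then have "charge w = 0"
    using boundary_path_counts[OF \<nu> path] p(2)[of 0] by (simp add: charge_def box_content_def)
  with path show ?thesis by (auto simp: boundary_word_iff_path)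
qed

lemma seq01_boundary:
  assumes "is_partition \<nu>"
  shows "boundary_word \<nu> (seq01 \<nu>)" "charge (seq01 \<nu>) = 0"
proof -
  have "seq01 \<nu> = (THE w. boundary_word \<nu> w \<and> charge w = 0)"
    by (simp add: seq01_def charge_def zeros_from_def ones_below_def)
  moreover have "\<exists>!w. boundary_word \<nu> w \<and> charge w = 0"
    using balanced_boundary_word_exists[OF assms] boundary_word_unique[OF assms] by metis
  ultimately show "boundary_word \<nu> (seq01 \<nu>)" "charge (seq01 \<nu>) = 0"
    using theI'[of "\<lambda>w. boundary_word \<nu> w \<and> charge w = 0"] by auto
qed

lemma diagram_seq01: "is_partition \<nu> \<Longrightarrow> diagram (seq01 \<nu>) = \<nu>"
  using boundary_word_diagram_eq seq01_boundary by metis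

lemma maya_word_seq01:
  assumes "is_partition \<nu>"
  obtains L M where "maya_word (seq01 \<nu>) L M"
proof -
  obtain p where "boundary_path \<nu> (seq01 \<nu>) p"
    using seq01_boundary(1)[OF assms] by (auto simp: boundary_word_iff_path)
  from boundary_path_counts[OF assms this] that show ?thesis by blast
qed

lemma maya_word_widen: "maya_word w L M \<Longrightarrow> L' \<le> L \<Longrightarrow> M \<le> M' \<Longrightarrow> maya_word w L' M'"
  by (auto simp: maya_word_def)

section \<open>Residue classes and quotients\<close>

definition residue_word :: "nat \<Rightarrow> nat \<Rightarrow> (int \<Rightarrow> nat) \<Rightarrow> int \<Rightarrow> nat" where
  "residue_word t i w = (\<lambda>j. w (int t * j + int i))"

lemma maya_word_residue:
  assumes "maya_word w (- int t * N) (int t * N)" "i < t"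
  shows "maya_word (residue_word t i w) (- N) N"
proof -
  interpret maya_word w "- int t * N" "int t * N" by fact
  show ?thesis
  proof
    fix k
    show "residue_word t i w k = 0 \<or> residue_word t i w k = 1"
      using binary by (simp add: residue_word_def)
    show "residue_word t i w k = 0" if "k < - N"
    proof -
      have "int t * (k + 1) \<le> int t * (- N)" using that by (intro mult_left_mono) auto
      then have "int t * k + int i < - int t * N"
        using assms(2) by (simp add: algebra_simps)
      then show ?thesis using low by (simp add: residue_word_def)
    qed
    show "residue_word t i w k = 1" if "N \<le> k"
    proof -
      have "int t * N \<le> int t * k" using that by (intro mult_left_mono) auto
      then have "int t * N \<le> int t * k + int i" by simp
      then show ?thesis using high by (simp add: residue_word_def)
    qed
  qed
qed

lemma maya_word_symmetric:
  assumes "is_partition \<nu>" "1 \<le> t"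
  obtains N0 where "\<And>N. N0 \<le> N \<Longrightarrow> maya_word (seq01 \<nu>) (- int t * N) (int t * N)"
proof -
  obtain L M where w: "maya_word (seq01 \<nu>) L M" using maya_word_seq01[OF assms(1)] .
  show ?thesis
  proof (rule that[of "max 0 (max (- L) M)"])
    fix N :: int assume N: "max 0 (max (- L) M) \<le> N"
    then have "1 * N \<le> int t * N" using assms(2) by (intro mult_right_mono) auto
    then show "maya_word (seq01 \<nu>) (- int t * N) (int t * N)"
      using N by (intro maya_word_widen[OF w]) auto
  qed
qed

lemma t_quotient_eq_diagram:
  assumes "is_partition lam" "i < t"
  shows "t_quotient t lam i = diagram (residue_word t i (seq01 lam))"
proof -
  obtain N where "maya_word (seq01 lam) (- int t * N) (int t * N)"
    using maya_word_symmetric[OF assms(1), of t] assms(2) by (metis less_one linorder_not_less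
        gr_implies_not0 order_refl)
  then have "maya_word (residue_word t i (seq01 lam)) (- N) N"
    using assms(2) by (rule maya_word_residue)
  then interpret maya_word "residue_word t i (seq01 lam)" "- N" N .
  show ?thesis
    unfolding t_quotient_def residue_word_def[symmetric]
  proof (rule the_equality)
    show "is_partition (diagram (residue_word t i (seq01 lam))) \<and>
        boundary_word (diagram (residue_word t i (seq01 lam))) (residue_word t i (seq01 lam))"
      using is_partition_diagram boundary_word_diagram by simp
  qed (use boundary_word_diagram_eq in blast)
qed

section \<open>Sums of squared hook lengths\<close>

lemma int_telescope:
  fixes F :: "int \<Rightarrow> 'a::ab_group_add"
  assumes "L \<le> U"
  shows "(\<Sum>j\<in>{L..<U}. F (j + 1) - F j) = F U - F L"
  using assms
proof (induction U rule: int_ge_induct)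
  case (step i)
  then have "{L..<i + 1} = insert i {L..<i}" by auto
  then show ?case using step by simp
qed simp

definition sum_squares :: "real \<Rightarrow> real" where
  "sum_squares x = x * (x + 1) * (2 * x + 1) / 6"

lemma sum_squares_diff: "sum_squares x - sum_squares (x - 1) = x\<^sup>2"
  by (simp add: sum_squares_def power2_eq_square field_simps)

context maya_word
begin

text \<open>
  In the row of a zero \<open>k\<close>, the hook lengths together with the differences \<open>k - j\<close> to the smaller
  zeros \<open>j\<close> exhaust \<open>1, \<dots>, k - L\<close>. So the sum of squared hook lengths is a polynomial in power
  sums of the zeros, as are the size and the content sum.
\<close>

lemma sum_hook_squares:
  "(\<Sum>b\<in>diagram w. (real (hook_length (diagram w) b))\<^sup>2)
    = (real (card (diagram w)))\<^sup>2 + (\<Sum>b\<in>diagram w. (real_of_int (box_content b))\<^sup>2)"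
proof -
  define Z where "Z = {k \<in> {L..<M}. w k = 0}"
  define m where "m = real_of_int (charge w - L)"
  define x where "x k = real_of_int (k - L)" for k
  define A1 where "A1 = (\<Sum>k\<in>Z. x k)"
  define A2 where "A2 = (\<Sum>k\<in>Z. (x k)\<^sup>2)"
  have finZ: "finite Z" unfolding Z_def by (rule finite_between)
  have fin_row: "finite {j \<in> {L..<k}. w j = 1}" for k
    by (rule finite_subset[of _ "{L..<k}"]) auto
  have "card Z = zeros_from w L"
    using bij_betw_same_card[OF bij_rows] by (simp add: Z_def)
  moreover have "real_of_int (int (zeros_from w L)) = m"
    by (simp only: zeros_from_low m_def)
  ultimately have cardZ: "real (card Z) = m" by simp
  have L_le: "L \<le> charge w" using zeros_from_low by linarith

  have "(\<Sum>b\<in>diagram w. (real (hook_length (diagram w) b))\<^sup>2)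
      = (\<Sum>(j, k)\<in>inversions w. (real_of_int (k - j))\<^sup>2)"
    using sum_hook_lengths[of "\<lambda>h. (real_of_int h)\<^sup>2"] by simp
  also have "\<dots> = (\<Sum>(k, j)\<in>(SIGMA k:Z. {j \<in> {L..<k}. w j = 1}). (real_of_int (k - j))\<^sup>2)"
  proof (rule sum.reindex_bij_witness[of _ prod.swap prod.swap])
    fix a assume "a \<in> inversions w"
    moreover from this have "a \<in> {j \<in> {L..<M}. w j = 1} \<times> {k \<in> {L..<M}. w k = 0}"
      using inversions_subset by (rule subsetD[rotated])
    ultimately show "prod.swap a \<in> (SIGMA k:Z. {j \<in> {L..<k}. w j = 1})"
      by (cases a) (simp add: inversions_def Z_def)
  qed (auto simp: inversions_def Z_def)
  also have "\<dots> = (\<Sum>k\<in>Z. \<Sum>j\<in>{j \<in> {L..<k}. w j = 1}. (real_of_int (k - j))\<^sup>2)"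
    by (rule sum.Sigma[symmetric, OF finZ]) (use fin_row in blast)
  also have "\<dots> = (\<Sum>k\<in>Z. sum_squares (x k) - (\<Sum>j\<in>{j \<in> Z. j < k}. (real_of_int (k - j))\<^sup>2))"
  proof (rule sum.cong[OF refl])
    fix k assume "k \<in> Z"
    then have k: "L \<le> k" "k < M" by (auto simp: Z_def)
    have "{L..<k} = {j \<in> {L..<k}. w j = 1} \<union> {j \<in> Z. j < k}"
      using k binary by (auto simp: Z_def)
    then have "(\<Sum>j\<in>{L..<k}. (real_of_int (k - j))\<^sup>2)
      = (\<Sum>j\<in>{j \<in> {L..<k}. w j = 1} \<union> {j \<in> Z. j < k}. (real_of_int (k - j))\<^sup>2)"
      by (rule sum.cong[OF _ refl])
    also have "\<dots> = (\<Sum>j\<in>{j \<in> {L..<k}. w j = 1}. (real_of_int (k - j))\<^sup>2)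
        + (\<Sum>j\<in>{j \<in> Z. j < k}. (real_of_int (k - j))\<^sup>2)"
      using finite_subset[OF _ finZ, of "{j \<in> Z. j < k}"]
      by (intro sum.union_disjoint fin_row) (auto simp: Z_def)
    finally have "(\<Sum>j\<in>{j \<in> {L..<k}. w j = 1}. (real_of_int (k - j))\<^sup>2)
        = (\<Sum>j\<in>{L..<k}. (real_of_int (k - j))\<^sup>2) - (\<Sum>j\<in>{j \<in> Z. j < k}. (real_of_int (k - j))\<^sup>2)"
      by simp
    moreover have "(\<Sum>j\<in>{L..<k}. (real_of_int (k - j))\<^sup>2)
      = (\<Sum>j\<in>{L..<k}. - sum_squares (real_of_int (k - (j + 1))) - - sum_squares (real_of_int (k - j)))"
    proof (rule sum.cong[OF refl])
      fix j
      show "(real_of_int (k - j))\<^sup>2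
        = - sum_squares (real_of_int (k - (j + 1))) - - sum_squares (real_of_int (k - j))"
        using sum_squares_diff[of "real_of_int (k - j)"] by (simp add: algebra_simps)
    qed
    moreover have "\<dots> = sum_squares (x k)"
      using int_telescope[OF k(1), of "\<lambda>j. - sum_squares (real_of_int (k - j))"]
      by (simp add: x_def sum_squares_def)
    ultimately show "(\<Sum>j\<in>{j \<in> {L..<k}. w j = 1}. (real_of_int (k - j))\<^sup>2)
        = sum_squares (x k) - (\<Sum>j\<in>{j \<in> Z. j < k}. (real_of_int (k - j))\<^sup>2)"
      by simp
  qed
  also have "\<dots> = (\<Sum>k\<in>Z. sum_squares (x k)) - (m * A2 - A1\<^sup>2)"
  proof -
    define q where "q k j = (real_of_int (k - j))\<^sup>2" for k j
    define T where "T = (\<Sum>k\<in>Z. \<Sum>j\<in>{j \<in> Z. j < k}. q k j)"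
    have T: "T = (\<Sum>k\<in>Z. \<Sum>j\<in>Z. if j < k then q k j else 0)"
      unfolding T_def using finZ by (simp add: sum.inter_filter)
    also have "\<dots> = (\<Sum>j\<in>Z. \<Sum>k\<in>Z. if j < k then q k j else 0)"
      by (rule sum.swap)
    finally have T': "T = (\<Sum>k\<in>Z. \<Sum>j\<in>Z. if k < j then q j k else 0)" .
    have "T + T = (\<Sum>k\<in>Z. \<Sum>j\<in>Z. (if j < k then q k j else 0) + (if k < j then q j k else 0))"
      by (subst (1) T, subst T') (simp add: sum.distrib)
    also have "\<dots> = (\<Sum>k\<in>Z. \<Sum>j\<in>Z. (x k)\<^sup>2 + (x j)\<^sup>2 - 2 * x k * x j)"
      by (intro sum.cong refl) (auto simp: q_def x_def power2_eq_square algebra_simps)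
    also have "\<dots> = (\<Sum>k\<in>Z. m * (x k)\<^sup>2 + A2 - 2 * x k * A1)"
      by (simp add: sum.distrib sum_subtractf cardZ A1_def A2_def sum_distrib_left)
    also have "\<dots> = 2 * (m * A2 - A1\<^sup>2)"
      by (simp add: sum.distrib sum_subtractf cardZ A1_def A2_def power2_eq_square
          flip: sum_distrib_left sum_distrib_right)
    finally show ?thesis by (simp add: sum_subtractf T_def q_def)
  qed
  finally have hooks: "(\<Sum>b\<in>diagram w. (real (hook_length (diagram w) b))\<^sup>2)
    = (\<Sum>k\<in>Z. sum_squares (x k)) - (m * A2 - A1\<^sup>2)" .

  have "real (card (diagram w)) = (\<Sum>k\<in>Z. x k) - (\<Sum>k\<in>{L..<charge w}. x k)"
    using sum_contents[of x "\<lambda>_. 1"] by (simp add: x_def Z_def)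
  also have "(\<Sum>k\<in>{L..<charge w}. x k)
    = (\<Sum>k\<in>{L..<charge w}. x (k + 1) * (x (k + 1) - 1) / 2 - x k * (x k - 1) / 2)"
    by (intro sum.cong refl) (simp add: x_def field_simps)
  also have "\<dots> = m * (m - 1) / 2"
    using int_telescope[OF L_le, of "\<lambda>k. x k * (x k - 1) / 2"] by (simp add: x_def m_def)
  finally have size: "real (card (diagram w)) = A1 - m * (m - 1) / 2"
    by (simp add: A1_def)

  define s where "s k = sum_squares (real_of_int (k - charge w))" for k
  have "(\<Sum>b\<in>diagram w. (real_of_int (box_content b))\<^sup>2)
      = (\<Sum>k\<in>Z. s k) - (\<Sum>k\<in>{L..<charge w}. s k)"
    using sum_contents[of s "\<lambda>c. (real_of_int (c - charge w))\<^sup>2"]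
      sum_squares_diff[of "real_of_int k - real_of_int (charge w)" for k]
    by (simp add: s_def Z_def algebra_simps)
  also have "(\<Sum>k\<in>{L..<charge w}. s k) = - (m\<^sup>2 * (m\<^sup>2 - 1) / 12)"
  proof -
    define F where "F k = (real_of_int (k - charge w))\<^sup>2 * ((real_of_int (k - charge w))\<^sup>2 - 1) / 12" for k
    have poly: "(y + 1)\<^sup>2 * ((y + 1)\<^sup>2 - 1) / 12 - y\<^sup>2 * (y\<^sup>2 - 1) / 12 = sum_squares y" for y
      by (simp add: sum_squares_def power2_eq_square field_simps)
    have "s k = F (k + 1) - F k" for k
      using poly[of "real_of_int (k - charge w)"] by (simp add: s_def F_def algebra_simps)
    then have "(\<Sum>k\<in>{L..<charge w}. s k) = F (charge w) - F L"
      using int_telescope[OF L_le, of F] by simp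
    then show ?thesis
      by (simp add: F_def m_def power2_commute[of "real_of_int L"])
  qed
  also have "(\<Sum>k\<in>Z. s k) = (\<Sum>k\<in>Z. sum_squares (x k)
      - (m * (x k)\<^sup>2 - m * (m - 1) * x k + m * (2 * m\<^sup>2 - 3 * m + 1) / 6))"
  proof (rule sum.cong[OF refl])
    fix k
    have "sum_squares (y - m)
      = sum_squares y - (m * y\<^sup>2 - m * (m - 1) * y + m * (2 * m\<^sup>2 - 3 * m + 1) / 6)" for y
      by (simp add: sum_squares_def power2_eq_square field_simps)
    from this[of "x k"] show "s k = sum_squares (x k)
        - (m * (x k)\<^sup>2 - m * (m - 1) * x k + m * (2 * m\<^sup>2 - 3 * m + 1) / 6)"
      by (simp add: s_def x_def m_def)
  qed
  also have "\<dots> = (\<Sum>k\<in>Z. sum_squares (x k))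
      - (m * A2 - m * (m - 1) * A1 + m * (m * (2 * m\<^sup>2 - 3 * m + 1) / 6))"
    by (simp add: sum.distrib sum_subtractf cardZ A1_def A2_def sum_distrib_left)
  finally have contents: "(\<Sum>b\<in>diagram w. (real_of_int (box_content b))\<^sup>2)
    = (\<Sum>k\<in>Z. sum_squares (x k))
      - (m * A2 - m * (m - 1) * A1 + m * (m * (2 * m\<^sup>2 - 3 * m + 1) / 6))
      - - (m\<^sup>2 * (m\<^sup>2 - 1) / 12)" .
  show ?thesis
    unfolding hooks size contents by (simp add: power2_eq_square field_simps)
qed

end

section \<open>Removable boxes and contents\<close>

lemma removable_box_above:
  assumes "is_partition \<nu>" "(a, b) \<in> \<nu>"
  obtains a' b' where "(a', b') \<in> removable_boxes \<nu>" "a \<le> a'" "b \<le> b'"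
proof -
  define S where "S = {(x, y) \<in> \<nu>. a \<le> x \<and> b \<le> y}"
  have "finite S"
    using assms(1) by (auto simp: S_def is_partition_def intro: finite_subset[of _ \<nu>])
  moreover have "(a, b) \<in> S" using assms(2) by (simp add: S_def)
  ultimately have "Max ((\<lambda>(x, y). x + y) ` S) \<in> (\<lambda>(x, y). x + y) ` S"
    by (intro Max_in) auto
  then obtain x y where xy: "(x, y) \<in> S" "x + y = Max ((\<lambda>(x, y). x + y) ` S)" by force
  have "x' + y' \<le> x + y" if "(x', y') \<in> S" for x' y'
    unfolding xy(2) using \<open>finite S\<close> that by (intro Max_ge) force+
  from this[of "Suc x" y] this[of x "Suc y"] xy(1) show ?thesis
    by (intro that[of x y]) (auto simp: S_def removable_boxes_def)
qed

lemma removable_boxes_antichain: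
  assumes "is_partition \<nu>" "(a, b) \<in> removable_boxes \<nu>" "(a', b') \<in> removable_boxes \<nu>"
    and "a \<le> a'" "b \<le> b'"
  shows "a = a' \<and> b = b'"
proof (rule ccontr)
  assume "\<not> (a = a' \<and> b = b')"
  then have "Suc a \<le> a' \<or> Suc b \<le> b'" using assms(4,5) by auto
  moreover have mem: "(a', b') \<in> \<nu>" "(a, b) \<in> \<nu>" using assms by (auto simp: removable_boxes_def)
  moreover have "1 \<le> a" "1 \<le> b" using mem assms(1) by (auto simp: is_partition_def)
  ultimately have "(Suc a, b) \<in> \<nu> \<or> (a, Suc b) \<in> \<nu>"
    using partition_closed[OF assms(1) mem(1)] assms(4,5) by auto
  then show False using assms(2) by (auto simp: removable_boxes_def)
qed

lemma corners_facts:
  assumes "is_partition \<nu>"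
  shows "set (corners \<nu>) = removable_boxes \<nu>"
    and "length (corners \<nu>) = card (removable_boxes \<nu>)"
    and "sorted_wrt (\<lambda>b b'. fst b > fst b') (corners \<nu>)"
proof -
  have "inj_on fst (removable_boxes \<nu>)"
  proof (rule inj_onI)
    fix P Q assume PQ: "P \<in> removable_boxes \<nu>" "Q \<in> removable_boxes \<nu>" "fst P = fst Q"
    then obtain a b b' where eqs: "P = (a, b)" "Q = (a, b')" by (metis prod.collapse)
    have "b = b'"
      using removable_boxes_antichain[OF assms, of a b a b']
        removable_boxes_antichain[OF assms, of a b' a b] PQ unfolding eqs by fastforce
    then show "P = Q" by (simp add: eqs)
  qed
  then interpret folding_insort_key "(\<le>)" "(<)" "removable_boxes \<nu>" fst
    by unfold_locales
  have class_constant: "linorder.sorted_key_list_of_set (\<le>) fst = sorted_key_list_of_set fst"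
    unfolding linorder.sorted_key_list_of_set_def[OF linorder_axioms] sorted_key_list_of_set_def
      linorder.insort_key_def[OF linorder_axioms] insort_key_def ..
  have fin: "finite (removable_boxes \<nu>)"
    using assms by (auto simp: removable_boxes_def is_partition_def intro: finite_subset[of _ \<nu>])
  show "set (corners \<nu>) = removable_boxes \<nu>"
    "length (corners \<nu>) = card (removable_boxes \<nu>)"
    unfolding corners_def set_rev length_rev
    using set_sorted_key_list_of_set[OF order_refl fin] length_sorted_key_list_of_set[OF order_refl]
    unfolding class_constant by simp_all
  show "sorted_wrt (\<lambda>b b'. fst b > fst b') (corners \<nu>)"
    using strict_sorted_key_list_of_set[OF order_refl] unfolding class_constant
    by (simp add: corners_def sorted_wrt_rev sorted_wrt_map)
qed

lemma sum_contents_rectangle: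
  assumes "p \<le> q"
  shows "(\<Sum>b\<in>{p<..q} \<times> {1..n}. 6 * box_content b)
    = 3 * int q * int n * (int n - int q) - 3 * int p * int n * (int n - int p)"
proof -
  have row: "(\<Sum>b\<in>{1..n}. 6 * (int b - int a)) = 3 * int n * (int n + 1 - 2 * int a)" for a
    by (induction n) (simp_all add: algebra_simps)
  have "(\<Sum>b\<in>{p<..q} \<times> {1..n}. 6 * box_content b)
    = (\<Sum>a\<in>{p<..q}. \<Sum>b\<in>{1..n}. 6 * (int b - int a))"
    by (subst sum.Sigma) (auto simp: box_content_def intro!: sum.cong)
  also have "\<dots> = (\<Sum>a\<in>{p<..q}. 3 * int n * (int n + 1 - 2 * int a))"
    by (simp only: row)
  also have "\<dots> = 3 * int q * int n * (int n - int q) - 3 * int p * int n * (int n - int p)"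
    using assms
  proof (induction q rule: dec_induct)
    case (step q)
    then have "{p<..Suc q} = insert (Suc q) {p<..q}" by auto
    then show ?case using step by (simp add: algebra_simps)
  qed simp
  finally show ?thesis .
qed

text \<open>
  Cutting along the rows of the removable boxes decomposes the diagram into rectangles
  \<open>(\<alpha>\<^sub>l\<^sub>+\<^sub>1, \<alpha>\<^sub>l] \<times> [1, \<beta>\<^sub>l]\<close>; with \<open>3 a b (b - a) = b\<^sup>3 - a\<^sup>3 - (b - a)\<^sup>3\<close> the
  pure cubes telescope.
\<close>

lemma q3_eq_sum_contents:
  assumes \<nu>: "is_partition \<nu>"
  shows "q3 \<nu> = 6 * (\<Sum>b\<in>\<nu>. box_content b)"
proof -
  define m where "m = card (removable_boxes \<nu>)"
  define A where "A l = (if 1 \<le> l \<and> l \<le> m then fst (corners \<nu> ! (l - 1)) else 0)" for l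
  define B where "B l = (if 1 \<le> l \<and> l \<le> m then snd (corners \<nu> ! (l - 1)) else 0)" for l
  have row: "corner_row \<nu> l = int (A l)" and col: "corner_col \<nu> l = int (B l)" for l
    by (simp_all add: corner_row_def corner_col_def A_def B_def m_def)
  note cf = corners_facts[OF \<nu>, folded m_def]
  have mem: "(A l, B l) \<in> removable_boxes \<nu>" if "1 \<le> l" "l \<le> m" for l
    using that cf(1,2) nth_mem[of "l - 1" "corners \<nu>"] by (simp add: A_def B_def)
  have ex: "\<exists>l. 1 \<le> l \<and> l \<le> m \<and> a = A l \<and> b = B l" if ab: "(a, b) \<in> removable_boxes \<nu>" for a b
  proof -
    obtain i where "i < m" "corners \<nu> ! i = (a, b)"
      using ab cf by (metis in_set_conv_nth)
    then show ?thesis by (intro exI[of _ "Suc i"]) (simp add: A_def B_def)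
  qed
  have pos: "1 \<le> A l" "1 \<le> B l" if "1 \<le> l" "l \<le> m" for l
    using mem[OF that] \<nu> by (auto simp: removable_boxes_def is_partition_def)
  have A_less: "A l' < A l" if "1 \<le> l" "l < l'" "l \<le> m" for l l'
  proof (cases "l' \<le> m")
    case True
    then show ?thesis
      using that sorted_wrt_nth_less[OF cf(3), of "l - 1" "l' - 1"] cf(2) by (simp add: A_def)
  next
    case False
    then show ?thesis using pos(1)[of l] that by (simp add: A_def)
  qed
  have B_less: "B l < B l'" if "1 \<le> l" "l < l'" "l' \<le> m" for l l'
    using removable_boxes_antichain[OF \<nu> mem[of l'] mem[of l]] A_less[of l l'] that by force
  define R where "R l = {A (Suc l)<..A l} \<times> {1..B l}" for l
  have union: "\<nu> = (\<Union>l\<in>{1..m}. R l)"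
  proof (intro equalityI subsetI)
    fix y assume "y \<in> \<nu>"
    moreover obtain a b where y: "y = (a, b)" by force
    ultimately have ab: "(a, b) \<in> \<nu>" by simp
    then obtain a' b' where ab': "(a', b') \<in> removable_boxes \<nu>" "a \<le> a'" "b \<le> b'"
      using removable_box_above[OF \<nu>] by blast
    then obtain k where k: "1 \<le> k" "k \<le> m" "a \<le> A k" "b \<le> B k" using ex by blast
    define l where "l = Max {l \<in> {1..m}. a \<le> A l}"
    have fin: "finite {l \<in> {1..m}. a \<le> A l}" by simp
    have kS: "k \<in> {l \<in> {1..m}. a \<le> A l}" using k by simp
    have "l \<in> {l \<in> {1..m}. a \<le> A l}" unfolding l_def using fin kS by (intro Max_in) auto
    then have l: "1 \<le> l" "l \<le> m" "a \<le> A l" by auto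
    have "k \<le> l" unfolding l_def using fin kS by (rule Max_ge)
    then have "b \<le> B l" using B_less[of k l] k l by (cases "k = l") auto
    moreover have "1 \<le> a" "1 \<le> b" using ab \<nu> by (auto simp: is_partition_def)
    moreover have "A (Suc l) < a"
    proof (rule ccontr)
      assume "\<not> A (Suc l) < a"
      then have "a \<le> A (Suc l)" by simp
      moreover from this have "Suc l \<le> m" using \<open>1 \<le> a\<close> by (auto simp: A_def split: if_splits)
      ultimately have "Suc l \<in> {l \<in> {1..m}. a \<le> A l}" by simp
      then have "Suc l \<le> l" unfolding l_def by (intro Max_ge fin)
      then show False by simp
    qed
    ultimately show "y \<in> (\<Union>l\<in>{1..m}. R l)" using l by (auto simp: R_def y)
  next
    fix y assume "y \<in> (\<Union>l\<in>{1..m}. R l)"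
    then obtain l a b where l: "1 \<le> l" "l \<le> m" "y = (a, b)" "A (Suc l) < a" "a \<le> A l" "1 \<le> b" "b \<le> B l"
      by (auto simp: R_def)
    have "(A l, B l) \<in> \<nu>" using mem[OF l(1,2)] by (simp add: removable_boxes_def)
    then show "y \<in> \<nu>" unfolding l(3) by (rule partition_closed[OF \<nu>]) (use l in auto)
  qed
  have disj: "R l \<inter> R l' = {}" if "1 \<le> l" "l < l'" "l' \<le> m" for l l'
    using A_less[of "Suc l" l'] that by (cases "l' = Suc l") (auto simp: R_def)
  have "(\<Sum>b\<in>\<nu>. 6 * box_content b) = (\<Sum>l\<in>{1..m}. \<Sum>b\<in>R l. 6 * box_content b)"
    unfolding union
  proof (rule sum.UNION_disjoint)
    show "\<forall>i\<in>{1..m}. \<forall>j\<in>{1..m}. i \<noteq> j \<longrightarrow> R i \<inter> R j = {}"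
      using disj by (metis Int_commute atLeastAtMost_iff linorder_neqE_nat)
  qed (auto simp: R_def)
  also have "\<dots> = (\<Sum>l\<in>{1..m}. 3 * int (A l) * int (B l) * (int (B l) - int (A l))
      - 3 * int (A (Suc l)) * int (B l) * (int (B l) - int (A (Suc l))))"
  proof (rule sum.cong[OF refl])
    fix l assume "l \<in> {1..m}"
    then have "A (Suc l) \<le> A l" using A_less[of l "Suc l"] by simp
    then show "(\<Sum>b\<in>R l. 6 * box_content b) = 3 * int (A l) * int (B l) * (int (B l) - int (A l))
      - 3 * int (A (Suc l)) * int (B l) * (int (B l) - int (A (Suc l)))"
      unfolding R_def by (rule sum_contents_rectangle)
  qed
  also have "\<dots> = (\<Sum>l\<in>{1..m}. (int (A (Suc l)) ^ 3 - int (A l) ^ 3)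
      + ((int (B l) - int (A (Suc l))) ^ 3 - (int (B l) - int (A l)) ^ 3))"
    by (intro sum.cong refl) (simp add: power3_eq_cube algebra_simps)
  also have "\<dots> = (\<Sum>l\<in>{1..m}. int (A (Suc l)) ^ 3 - int (A l) ^ 3)
      + ((\<Sum>l\<in>{1..m}. (int (B l) - int (A (Suc l))) ^ 3) - (\<Sum>l\<in>{1..m}. (int (B l) - int (A l)) ^ 3))"
    by (simp add: sum.distrib sum_subtractf)
  also have "(\<Sum>l\<in>{1..m}. int (A (Suc l)) ^ 3 - int (A l) ^ 3) = int (A (Suc m)) ^ 3 - int (A 1) ^ 3"
    using sum_Suc_diff[of 1 m "\<lambda>l. int (A l) ^ 3"] by simp
  also have "A (Suc m) = 0" by (simp add: A_def)
  also have "int 0 ^ 3 - int (A 1) ^ 3 = (int (B 0) - int (A (Suc 0))) ^ 3"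
    by (simp add: B_def power3_eq_cube)
  finally have "(\<Sum>b\<in>\<nu>. 6 * box_content b)
      = (\<Sum>l = 0..m. (int (B l) - int (A (Suc l))) ^ 3) - (\<Sum>l\<in>{1..m}. (int (B l) - int (A l)) ^ 3)"
    by (simp add: sum.atLeast_Suc_atMost[of 0 m])
  then show ?thesis by (simp add: q3_def row col sum_distrib_left flip: m_def)
qed

section \<open>Cores\<close>

lemma charge_swap:
  assumes "maya_word u L M" "maya_word v L' M'"
    and q: "u q = 1" "u (q + 1) = 0" and v: "v = u(q := 0, q + 1 := 1)"
  shows "charge u = charge v"
proof -
  interpret u: maya_word u L M by fact
  interpret v: maya_word v L' M' by fact
  have same: "v k = u k" if "k < q \<or> q + 2 \<le> k" for k using that by (auto simp: v)
  have "v q = 0" "v (q + 1) = 1" by (simp_all add: v)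
  then have "ones_below v (q + 2) = Suc (ones_below v q)"
    using v.zero_step[of q] v.one_step[of "q + 1"] by (simp add: add.assoc)
  moreover have "ones_below u (q + 2) = Suc (ones_below u q)"
    using u.one_step[OF q(1)] u.zero_step[OF q(2)] by (simp add: add.assoc)
  moreover have "ones_below u q = ones_below v q"
    using same by (auto simp: ones_below_def intro!: arg_cong[where f = card])
  moreover have "zeros_from u (q + 2) = zeros_from v (q + 2)"
    using same by (auto simp: zeros_from_def intro!: arg_cong[where f = card])
  ultimately show ?thesis using u.diagonal[of "q + 2"] v.diagonal[of "q + 2"] by simp
qed

lemma maya_word_residue_seq01:
  assumes "is_partition \<nu>" "i < t"
  obtains N where "maya_word (residue_word t i (seq01 \<nu>)) (- N) N"
proof -
  have "1 \<le> t" using assms(2) by simp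
  then obtain N where "maya_word (seq01 \<nu>) (- int t * N) (int t * N)"
    using maya_word_symmetric[OF assms(1)] by (metis order_refl)
  then show ?thesis using assms(2) that maya_word_residue by blast
qed

lemma charge_residue_removes_hook:
  assumes "removes_hook t lam \<nu>" "i < t"
  shows "charge (residue_word t i (seq01 lam)) = charge (residue_word t i (seq01 \<nu>))"
proof -
  obtain j where parts: "is_partition lam" "is_partition \<nu>"
    and j: "seq01 lam j = 1" "seq01 lam (j + int t) = 0"
    and eq: "seq01 \<nu> = (seq01 lam)(j := 0, j + int t := 1)"
    using assms(1) by (auto simp: removes_hook_def)
  obtain N N' where u: "maya_word (residue_word t i (seq01 lam)) (- N) N"
    and v: "maya_word (residue_word t i (seq01 \<nu>)) (- N') N'"
    using maya_word_residue_seq01[OF parts(1) assms(2)] maya_word_residue_seq01[OF parts(2) assms(2)]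
    by metis
  have mod_i: "(int t * k + int i) mod int t = int i" for k using assms(2) by simp
  show ?thesis
  proof (cases "j mod int t = int i")
    case True
    define q where "q = j div int t"
    have jq: "j = int t * q + int i" using True mult_div_mod_eq[of "int t" j] by (simp add: q_def)
    have "int t * k + int i = j \<longleftrightarrow> k = q" "int t * k + int i = j + int t \<longleftrightarrow> k = q + 1" for k
    proof -
      have "j + int t = int t * (q + 1) + int i" by (simp add: jq algebra_simps)
      then show "int t * k + int i = j \<longleftrightarrow> k = q" "int t * k + int i = j + int t \<longleftrightarrow> k = q + 1"
        using assms(2) by (simp_all add: jq)
    qed
    then have "residue_word t i (seq01 \<nu>) = (residue_word t i (seq01 lam))(q := 0, q + 1 := 1)"
      by (auto simp: residue_word_def eq fun_eq_iff)
    moreover have "residue_word t i (seq01 lam) q = 1" "residue_word t i (seq01 lam) (q + 1) = 0"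
      using j by (simp_all add: residue_word_def jq algebra_simps)
    ultimately show ?thesis using charge_swap[OF u v] by blast
  next
    case False
    then have "int t * k + int i \<noteq> j" "int t * k + int i \<noteq> j + int t" for k
      using mod_i[of k] by (auto simp: mod_add_self2 dest: arg_cong[where f = "\<lambda>x. x mod int t"])
    then have "residue_word t i (seq01 \<nu>) = residue_word t i (seq01 lam)"
      by (simp add: residue_word_def eq)
    then show ?thesis by simp
  qed
qed

lemma charge_residue_has_core:
  assumes "has_core t lam mu" "i < t"
  shows "charge (residue_word t i (seq01 lam)) = charge (residue_word t i (seq01 mu))"
proof -
  have "(removes_hook t)\<^sup>*\<^sup>* lam mu" using assms(1) by (simp add: has_core_def)
  then show ?thesis
    by induction (use charge_residue_removes_hook assms(2) in auto)
qed

lemma core_residue: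
  assumes core: "is_core t mu" and i: "i < t"
  defines "u \<equiv> residue_word t i (seq01 mu)"
  shows "diagram u = {}" "core_d t mu i = charge u"
proof -
  have part: "is_partition mu" using core by (simp add: is_core_def)
  obtain L M where w: "maya_word (seq01 mu) L M" using maya_word_seq01[OF part] .
  interpret w: maya_word "seq01 mu" L M by fact
  obtain N where "maya_word u (- N) N"
    using maya_word_residue_seq01[OF part i] unfolding u_def by blast
  then interpret u: maya_word u "- N" N .
  have no_inv: False if "j < k" "u j = 1" "u k = 0" for j k
  proof -
    let ?j = "int t * j + int i" and ?k = "int t * k + int i"
    have inv: "(?j, ?k) \<in> inversions (seq01 mu)"
      using that i by (simp add: inversions_def u_def residue_word_def)
    let ?b = "(zeros_from (seq01 mu) ?k, ones_below (seq01 mu) (?j + 1))"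
    have "?b \<in> mu"
      using w.inversion_box_iff[of ?j ?k] inv diagram_seq01[OF part] by (simp add: inversions_def)
    moreover have "int (hook_length mu ?b) = int t * (k - j)"
      using w.hook_length_inversion[OF inv] diagram_seq01[OF part] by (simp add: algebra_simps)
    then have "t dvd hook_length mu ?b" by (metis dvd_triv_left int_dvd_int_iff)
    ultimately show False using core by (auto simp: is_core_def)
  qed
  define d where "d = charge u"
  have "zeros_from u d = ones_below u d" using u.diagonal[of d] by (simp add: d_def)
  moreover have "{k. d \<le> k \<and> u k = 0} = {} \<or> {k. k < d \<and> u k = 1} = {}"
    using no_inv by (auto dest: order.strict_trans2)
  ultimately have "{k. d \<le> k \<and> u k = 0} = {}" "{k. k < d \<and> u k = 1} = {}"
    using u.finite_zeros[of d] u.finite_ones[of d] unfolding zeros_from_def ones_below_def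
    by (metis card_0_eq card.empty)+
  then have ge: "\<And>k. d \<le> k \<Longrightarrow> u k = 1" and lt: "\<And>k. k < d \<Longrightarrow> u k = 0"
    using u.binary by blast+
  interpret d: maya_word u d d by standard (use u.binary ge lt in auto)
  show "diagram u = {}"
    using d.diagram_bounds d.zeros_from_high[of d] by fastforce
  have "core_b t mu i = int t * d + int i"
    unfolding core_b_def
  proof (rule Least_equality)
    show "(int t * d + int i) mod int t = int i mod int t \<and> seq01 mu (int t * d + int i) = 1"
      using ge[of d] by (simp add: u_def residue_word_def)
    fix j assume j: "j mod int t = int i mod int t \<and> seq01 mu j = 1"
    define q where "q = j div int t"
    have jq: "j = int t * q + int i"
      using j i mult_div_mod_eq[of "int t" j] by (simp add: q_def)
    then have "u q = 1" using j by (simp add: u_def residue_word_def)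
    then have "d \<le> q" using lt[of q] by force
    then show "int t * d + int i \<le> j" unfolding jq by (simp add: mult_left_mono)
  qed
  then show "core_d t mu i = charge u" using i by (simp add: core_d_def d_def)
qed

section \<open>Hooks and contents divisible by \<open>t\<close>\<close>

lemma sum_by_residues:
  fixes F :: "int \<Rightarrow> real"
  assumes "1 \<le> t"
  shows "(\<Sum>k\<in>{k \<in> {- int t * N..<int t * N}. P k}. F k)
    = (\<Sum>i = 0..t - 1. \<Sum>j\<in>{j \<in> {- N..<N}. P (int t * j + int i)}. F (int t * j + int i))"
proof -
  have fin: "finite {j \<in> {- N..<N}. P (int t * j + int i)}" for i
    by (rule finite_subset[of _ "{- N..<N}"]) auto
  have range: "- int t * N \<le> int t * j + int i \<and> int t * j + int i < int t * N \<longleftrightarrow> - N \<le> j \<and> j < N"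
    if "i < t" for i j
  proof -
    have "int t * a + int t \<le> int t * b" if "a < b" for a b
      using mult_left_mono[of "a + 1" b "int t"] that by (simp add: distrib_left)
    moreover have "int t * a \<le> int t * b" if "a \<le> b" for a b
      using that by (rule mult_left_mono) simp
    ultimately show ?thesis
      using that by (smt (verit, best) mult_minus_left mult_minus_right of_nat_0_le_iff of_nat_less_iff)
  qed
  have "(\<Sum>k\<in>{k \<in> {- int t * N..<int t * N}. P k}. F k)
    = (\<Sum>(i, j)\<in>(SIGMA i:{0..t - 1}. {j \<in> {- N..<N}. P (int t * j + int i)}). F (int t * j + int i))"
  proof (rule sum.reindex_bij_witness[of _ "\<lambda>(i, j). int t * j + int i"
        "\<lambda>k. (nat (k mod int t), k div int t)"])
    fix k assume k: "k \<in> {k \<in> {- int t * N..<int t * N}. P k}"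
    have "nat (k mod int t) < t" using assms by (simp add: nat_less_iff)
    moreover have eq: "int t * (k div int t) + int (nat (k mod int t)) = k" using assms by simp
    ultimately show "(nat (k mod int t), k div int t)
        \<in> (SIGMA i:{0..t - 1}. {j \<in> {- N..<N}. P (int t * j + int i)})"
      using k range[of "nat (k mod int t)" "k div int t"] by auto
    show "(case (nat (k mod int t), k div int t) of (i, j) \<Rightarrow> int t * j + int i) = k"
      using eq by simp
    show "(case (nat (k mod int t), k div int t) of (i, j) \<Rightarrow> F (int t * j + int i)) = F k"
      using eq by simp
  next
    fix p assume "p \<in> (SIGMA i:{0..t - 1}. {j \<in> {- N..<N}. P (int t * j + int i)})"
    then obtain i j where p: "p = (i, j)" "i < t" "- N \<le> j" "j < N" "P (int t * j + int i)"
      using assms by (cases p) auto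
    then show "(case p of (i, j) \<Rightarrow> int t * j + int i) \<in> {k \<in> {- int t * N..<int t * N}. P k}"
      using range[of i j] by auto
    show "(nat ((case p of (i, j) \<Rightarrow> int t * j + int i) mod int t),
        (case p of (i, j) \<Rightarrow> int t * j + int i) div int t) = p"
      using p by simp
  qed
  also have "\<dots> = (\<Sum>i = 0..t - 1. \<Sum>j\<in>{j \<in> {- N..<N}. P (int t * j + int i)}. F (int t * j + int i))"
    by (rule sum.Sigma[symmetric]) (use fin in auto)
  finally show ?thesis .
qed

lemma sum_contents_dvd:
  assumes part: "is_partition \<nu>" and t: "1 \<le> t"
    and w: "maya_word (seq01 \<nu>) (- int t * N) (int t * N)"
  defines "u \<equiv> \<lambda>i. residue_word t i (seq01 \<nu>)"
  shows "(\<Sum>b\<in>{b \<in> \<nu>. int t dvd box_content b}. (real_of_int (box_content b))\<^sup>2)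
    = real t ^ 2 * (\<Sum>i = 0..t - 1. (\<Sum>b\<in>diagram (u i). (real_of_int (box_content b + charge (u i)))\<^sup>2)
        + (\<Sum>j\<in>{- N..<charge (u i)}. sum_squares (real_of_int j)))
      - (\<Sum>k\<in>{- int t * N..<0}. real t ^ 2 * sum_squares (real_of_int (k div int t)))"
proof -
  interpret w: maya_word "seq01 \<nu>" "- int t * N" "int t * N" by fact
  define S where "S k = real t ^ 2 * sum_squares (real_of_int (k div int t))" for k
  define g where "g c = (if int t dvd c then (real_of_int c)\<^sup>2 else 0)" for c
  have S: "S k - S (k - 1) = g k" for k
  proof (cases "int t dvd k")
    case True
    then obtain q where k: "k = int t * q" by blast
    have "(k - 1) div int t = q - 1"
      by (rule int_div_pos_eq[where r = "int t - 1"]) (use t in \<open>auto simp: k algebra_simps\<close>)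
    then have "S k - S (k - 1) = real t ^ 2 * (sum_squares (real_of_int q) - sum_squares (real_of_int q - 1))"
      using t by (simp add: S_def k right_diff_distrib)
    also have "\<dots> = g k" unfolding sum_squares_diff using k by (simp add: g_def power_mult_distrib)
    finally show ?thesis .
  next
    case False
    then have "0 < k mod int t" using t by (simp add: dvd_eq_mod_eq_0 order_less_le)
    moreover have "k mod int t < int t" using t by simp
    moreover have "k - 1 = int t * (k div int t) + (k mod int t - 1)" by simp
    ultimately have "(k - 1) div int t = k div int t" 
      by (intro int_div_pos_eq[where r = "k mod int t - 1"]) simp_all
    with False show ?thesis by (simp add: S_def g_def)
  qed
  have "(\<Sum>b\<in>{b \<in> \<nu>. int t dvd box_content b}. (real_of_int (box_content b))\<^sup>2)
    = (\<Sum>b\<in>\<nu>. g (box_content b))"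
    using part by (simp add: g_def is_partition_def sum.inter_filter)
  also have "\<dots> = (\<Sum>k\<in>{k \<in> {- int t * N..<int t * N}. seq01 \<nu> k = 0}. S k) - (\<Sum>k\<in>{- int t * N..<0}. S k)"
    using w.sum_contents[of S g, OF S] diagram_seq01[OF part] seq01_boundary(2)[OF part] by simp
  also have "(\<Sum>k\<in>{k \<in> {- int t * N..<int t * N}. seq01 \<nu> k = 0}. S k)
      = (\<Sum>i = 0..t - 1. \<Sum>j\<in>{j \<in> {- N..<N}. u i j = 0}. S (int t * j + int i))"
    unfolding sum_by_residues[OF t] by (simp add: u_def residue_word_def)
  also have "\<dots> = (\<Sum>i = 0..t - 1. real t ^ 2 * ((\<Sum>b\<in>diagram (u i). (real_of_int (box_content b + charge (u i)))\<^sup>2)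
        + (\<Sum>j\<in>{- N..<charge (u i)}. sum_squares (real_of_int j))))"
  proof (rule sum.cong[OF refl])
    fix i assume "i \<in> {0..t - 1}"
    then have i: "i < t" using t by auto
    interpret u: maya_word "u i" "- N" N unfolding u_def using w i by (rule maya_word_residue)
    have "S (int t * j + int i) = real t ^ 2 * sum_squares (real_of_int j)" for j
      using i by (simp add: S_def)
    then have "(\<Sum>j\<in>{j \<in> {- N..<N}. u i j = 0}. S (int t * j + int i))
      = real t ^ 2 * (\<Sum>j\<in>{j \<in> {- N..<N}. u i j = 0}. sum_squares (real_of_int j))"
      by (simp add: sum_distrib_left)
    moreover have "sum_squares (real_of_int k) - sum_squares (real_of_int (k - 1)) = (real_of_int k)\<^sup>2" for k
      using sum_squares_diff[of "real_of_int k"] by simp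
    note u.sum_contents[of "\<lambda>k. sum_squares (real_of_int k)" "\<lambda>k. (real_of_int k)\<^sup>2", OF this]
    ultimately show "(\<Sum>j\<in>{j \<in> {- N..<N}. u i j = 0}. S (int t * j + int i))
      = real t ^ 2 * ((\<Sum>b\<in>diagram (u i). (real_of_int (box_content b + charge (u i)))\<^sup>2)
        + (\<Sum>j\<in>{- N..<charge (u i)}. sum_squares (real_of_int j)))"
      by simp
  qed
  finally show ?thesis by (simp only: S_def sum_distrib_left)
qed

lemma sum_hooks_dvd:
  assumes part: "is_partition \<nu>" and t: "1 \<le> t"
  defines "u \<equiv> \<lambda>i. residue_word t i (seq01 \<nu>)"
  shows "(\<Sum>b\<in>{b \<in> \<nu>. t dvd hook_length \<nu> b}. (real (hook_length \<nu> b))\<^sup>2)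
    = real t ^ 2 * (\<Sum>i = 0..t - 1. \<Sum>b\<in>diagram (u i). (real (hook_length (diagram (u i)) b))\<^sup>2)"
proof -
  obtain L M where w: "maya_word (seq01 \<nu>) L M" using maya_word_seq01[OF part] .
  interpret w: maya_word "seq01 \<nu>" L M by fact
  have u: "\<exists>N. maya_word (u i) (- N) N" if "i \<in> {0..t - 1}" for i
  proof -
    have "i < t" using that t by auto
    then show ?thesis using maya_word_residue_seq01[OF part] unfolding u_def by blast
  qed
  define g where "g h = (if int t dvd h then (real_of_int h)\<^sup>2 else 0)" for h
  have "(\<Sum>b\<in>{b \<in> \<nu>. t dvd hook_length \<nu> b}. (real (hook_length \<nu> b))\<^sup>2)
    = (\<Sum>b\<in>\<nu>. g (int (hook_length \<nu> b)))"
    using part by (simp add: g_def is_partition_def sum.inter_filter cong: if_cong)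
  also have "\<dots> = (\<Sum>(j, k)\<in>inversions (seq01 \<nu>). g (k - j))"
    using w.sum_hook_lengths[of g] diagram_seq01[OF part] by simp
  also have "\<dots> = (\<Sum>p\<in>{(j, k) \<in> inversions (seq01 \<nu>). int t dvd k - j}. (real_of_int (snd p - fst p))\<^sup>2)"
    by (rule sum.mono_neutral_cong_right[OF w.finite_inversions]) (auto simp: g_def split: if_splits)
  also have "\<dots> = (\<Sum>(i, j, k)\<in>(SIGMA i:{0..t - 1}. inversions (u i)). real t ^ 2 * (real_of_int (k - j))\<^sup>2)"
  proof (rule sum.reindex_bij_witness[of _ "\<lambda>(i, j, k). (int t * j + int i, int t * k + int i)"
        "\<lambda>(j, k). (nat (j mod int t), j div int t, k div int t)"])
    fix p assume "p \<in> {(j, k) \<in> inversions (seq01 \<nu>). int t dvd k - j}"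
    then obtain j k where p: "p = (j, k)" "(j, k) \<in> inversions (seq01 \<nu>)" "int t dvd k - j" by auto
    define i where "i = nat (j mod int t)"
    have i: "i < t" "int i = j mod int t" using t by (simp_all add: i_def nat_less_iff)
    have jk: "int t * (j div int t) + int i = j" "int t * (k div int t) + int i = k"
      using i p(3) mult_div_mod_eq[of "int t" j] mult_div_mod_eq[of "int t" k]
      by (simp_all add: mod_eq_dvd_iff[symmetric])
    have "j < k" using p(2) by (simp add: inversions_def)
    then have "int t * (j div int t) < int t * (k div int t)" using jk by linarith
    then have "j div int t < k div int t" using t by simp
    then have inv: "(j div int t, k div int t) \<in> inversions (u i)"
      using p(2) jk by (simp add: inversions_def u_def residue_word_def)
    show "(case p of (j, k) \<Rightarrow> (nat (j mod int t), j div int t, k div int t))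
        \<in> (SIGMA i:{0..t - 1}. inversions (u i))"
      using inv i by (simp add: p(1) flip: i_def)
    show "(case case p of (j, k) \<Rightarrow> (nat (j mod int t), j div int t, k div int t) of
        (i, j, k) \<Rightarrow> (int t * j + int i, int t * k + int i)) = p"
      using jk by (simp add: p(1) flip: i_def)
    have "k - j = int t * (k div int t - j div int t)"
      using jk by (simp add: right_diff_distrib)
    then have "real_of_int (k - j) = real t * real_of_int (k div int t - j div int t)"
      by (metis of_int_mult of_int_of_nat_eq)
    then show "(case case p of (j, k) \<Rightarrow> (nat (j mod int t), j div int t, k div int t) of
        (i, j, k) \<Rightarrow> real t ^ 2 * (real_of_int (k - j))\<^sup>2) = (real_of_int (snd p - fst p))\<^sup>2"
      by (simp add: p(1) power_mult_distrib)
  next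
    fix p assume "p \<in> (SIGMA i:{0..t - 1}. inversions (u i))"
    then obtain i j k where p: "p = (i, j, k)" "i < t" "(j, k) \<in> inversions (u i)"
      using t by (cases p) auto
    then show "(case p of (i, j, k) \<Rightarrow> (int t * j + int i, int t * k + int i))
        \<in> {(j, k) \<in> inversions (seq01 \<nu>). int t dvd k - j}"
      by (auto simp: inversions_def u_def residue_word_def simp flip: right_diff_distrib)
    show "(case case p of (i, j, k) \<Rightarrow> (int t * j + int i, int t * k + int i) of
        (j, k) \<Rightarrow> (nat (j mod int t), j div int t, k div int t)) = p"
      using p by simp
  qed
  also have "\<dots> = (\<Sum>i = 0..t - 1. \<Sum>(j, k)\<in>inversions (u i). real t ^ 2 * (real_of_int (k - j))\<^sup>2)"
    by (rule sum.Sigma[symmetric]) (use u maya_word.finite_inversions in blast)+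
  also have "\<dots> = (\<Sum>i = 0..t - 1. real t ^ 2 * (\<Sum>b\<in>diagram (u i). (real (hook_length (diagram (u i)) b))\<^sup>2))"
  proof (rule sum.cong[OF refl])
    fix i assume "i \<in> {0..t - 1}"
    then obtain N where "maya_word (u i) (- N) N" using u by blast
    from maya_word.sum_hook_lengths[OF this, of "\<lambda>h. (real_of_int h)\<^sup>2"]
    show "(\<Sum>(j, k)\<in>inversions (u i). real t ^ 2 * (real_of_int (k - j))\<^sup>2)
      = real t ^ 2 * (\<Sum>b\<in>diagram (u i). (real (hook_length (diagram (u i)) b))\<^sup>2)"
      by (simp add: case_prod_beta flip: sum_distrib_left)
  qed
  finally show ?thesis by (simp only: sum_distrib_left)
qed

theorem theorem6p2:
  fixes t :: nat and mu lam :: "box set"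
  assumes "t \<ge> 1" and "is_core t mu"
    and "is_partition lam" and "has_core t lam mu"
  shows "(\<Sum>b \<in> {b \<in> lam. t dvd hook_length lam b}. real (hook_length lam b) ^ 2)
       - (\<Sum>b \<in> {b \<in> lam. int t dvd box_content b}. real_of_int (box_content b) ^ 2)
       = real t ^ 2 * (\<Sum>i = 0..t - 1.
            real (card (t_quotient t lam i)) ^ 2
            - real_of_int (core_d t mu i) ^ 2 * real (card (t_quotient t lam i))
            - 1 / 3 * real_of_int (core_d t mu i) * real_of_int (q3 (t_quotient t lam i)))
         - (\<Sum>b \<in> {b \<in> mu. int t dvd box_content b}. real_of_int (box_content b) ^ 2)"
proof -
  define u where "u i = residue_word t i (seq01 lam)" for i
  define v where "v i = residue_word t i (seq01 mu)" for i
  have part: "is_partition mu" using assms(2) by (simp add: is_core_def)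
  obtain N1 N2 where
    N1: "\<And>N. N1 \<le> N \<Longrightarrow> maya_word (seq01 lam) (- int t * N) (int t * N)" and
    N2: "\<And>N. N2 \<le> N \<Longrightarrow> maya_word (seq01 mu) (- int t * N) (int t * N)"
    using maya_word_symmetric[OF assms(3,1)] maya_word_symmetric[OF part assms(1)] by metis
  define N where "N = max N1 N2"
  have wl: "maya_word (seq01 lam) (- int t * N) (int t * N)" by (rule N1) (simp add: N_def)
  have wm: "maya_word (seq01 mu) (- int t * N) (int t * N)" by (rule N2) (simp add: N_def)
  let ?C = "\<lambda>i. \<Sum>b\<in>diagram (u i). (real_of_int (box_content b + charge (u i)))\<^sup>2"
  let ?H = "\<lambda>i. \<Sum>b\<in>diagram (u i). (real (hook_length (diagram (u i)) b))\<^sup>2"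
  have contents: "(\<Sum>b \<in> {b \<in> lam. int t dvd box_content b}. real_of_int (box_content b) ^ 2)
      - (\<Sum>b \<in> {b \<in> mu. int t dvd box_content b}. real_of_int (box_content b) ^ 2)
    = real t ^ 2 * (\<Sum>i = 0..t - 1. ?C i)"
  proof -
    have "(\<Sum>i = 0..t - 1. (\<Sum>b\<in>diagram (v i). (real_of_int (box_content b + charge (v i)))\<^sup>2)
        + (\<Sum>j\<in>{- N..<charge (v i)}. sum_squares (real_of_int j)))
      = (\<Sum>i = 0..t - 1. (\<Sum>j\<in>{- N..<charge (u i)}. sum_squares (real_of_int j)))"
    proof (rule sum.cong[OF refl])
      fix i assume "i \<in> {0..t - 1}"
      then have "i < t" using assms(1) by auto
      then have "diagram (v i) = {}" "charge (v i) = charge (u i)"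
        using core_residue(1)[OF assms(2)] charge_residue_has_core[OF assms(4)]
        by (simp_all add: u_def v_def)
      then show "(\<Sum>b\<in>diagram (v i). (real_of_int (box_content b + charge (v i)))\<^sup>2)
        + (\<Sum>j\<in>{- N..<charge (v i)}. sum_squares (real_of_int j))
        = (\<Sum>j\<in>{- N..<charge (u i)}. sum_squares (real_of_int j))"
        by simp
    qed
    then show ?thesis
      unfolding sum_contents_dvd[OF assms(3,1) wl, folded u_def]
        sum_contents_dvd[OF part assms(1) wm, folded v_def]
      by (simp add: sum.distrib algebra_simps)
  qed
  have hooks: "(\<Sum>b \<in> {b \<in> lam. t dvd hook_length lam b}. real (hook_length lam b) ^ 2)
      = real t ^ 2 * (\<Sum>i = 0..t - 1. ?H i)"
    using sum_hooks_dvd[OF assms(3,1)] by (simp add: u_def)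
  have quotients: "(\<Sum>i = 0..t - 1.
            real (card (t_quotient t lam i)) ^ 2
            - real_of_int (core_d t mu i) ^ 2 * real (card (t_quotient t lam i))
            - 1 / 3 * real_of_int (core_d t mu i) * real_of_int (q3 (t_quotient t lam i)))
      = (\<Sum>i = 0..t - 1. ?H i - ?C i)"
  proof (rule sum.cong[OF refl])
    fix i assume "i \<in> {0..t - 1}"
    then have i: "i < t" using assms(1) by auto
    interpret maya_word "u i" "- N" N unfolding u_def using wl i by (rule maya_word_residue)
    let ?d = "real_of_int (charge (u i))"
    have "core_d t mu i = charge (u i)"
      using core_residue(2)[OF assms(2) i] charge_residue_has_core[OF assms(4) i]
      by (simp add: u_def)
    moreover have "t_quotient t lam i = diagram (u i)"
      using t_quotient_eq_diagram[OF assms(3) i] by (simp add: u_def)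
    moreover have "?C i = (\<Sum>b\<in>diagram (u i). (real_of_int (box_content b))\<^sup>2
        + 2 * ?d * real_of_int (box_content b) + ?d\<^sup>2)"
      by (intro sum.cong refl) (simp add: power2_eq_square algebra_simps)
    then have "?C i = (\<Sum>b\<in>diagram (u i). (real_of_int (box_content b))\<^sup>2)
        + 2 * ?d * (\<Sum>b\<in>diagram (u i). real_of_int (box_content b))
        + real (card (diagram (u i))) * ?d\<^sup>2"
      by (simp add: sum.distrib sum_distrib_left)
    moreover have "real_of_int (q3 (diagram (u i))) = 6 * (\<Sum>b\<in>diagram (u i). real_of_int (box_content b))"
      using q3_eq_sum_contents[OF is_partition_diagram] by simp
    ultimately show "real (card (t_quotient t lam i)) ^ 2
            - real_of_int (core_d t mu i) ^ 2 * real (card (t_quotient t lam i))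
            - 1 / 3 * real_of_int (core_d t mu i) * real_of_int (q3 (t_quotient t lam i)) = ?H i - ?C i"
      using sum_hook_squares by simp
  qed
  show ?thesis
    unfolding hooks quotients using contents by (simp add: sum_subtractf right_diff_distrib)
qed

end
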